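(* For every complex number $\beta$, $$\sum_{\lambda\in\mathcal P}x^{|\lambda|+b(\lambda)}\prod_{v\in\lambda}\frac{c(v)+1-\beta}{h_v\,(1-x^{h_v})}=\sum_{\lambda\in\mathcal P}x^{|\lambda|}\prod_{v\in\lambda}\frac{h_v^2-\beta}{h_v^2}.$$
   Context: $\mathcal P$ is the set of all partitions $\lambda=(\lambda_1\ge\cdots\ge\lambda_\ell>0)$, $|\lambda|=\sum_i\lambda_i$. The boxes of $\lambda$ are the pairs $(i,j)$ with $1\le i\le\ell$, $1\le j\le\lambda_i$. For a box $v=(i,j)$, the hook length is $h_v=\lambda_i-j+\lambda'_j-i+1$ with $\lambda'_j=\#\{k:\lambda_k\ge j\}$, and the content is $c(v)=j-i$. Also $b(\lambda)=\sum_i(i-1)\lambda_i$. Both sides are formal power series in $x$ (each $1/(1-x^h)$ expanded as a power series). *)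

theory Defs
  imports "HOL-Analysis.Analysis" "HOL-Computational_Algebra.Formal_Power_Series"
begin

text \<open>
  A partition is the weakly decreasing list of its (positive) parts; the empty list is the empty
  partition.  Rows and columns are numbered from 1.
\<close>

definition partitions :: "nat list set" where
  "partitions = {l. sorted_wrt (\<ge>) l \<and> (\<forall>p \<in> set l. p > 0)}"

definition part :: "nat list \<Rightarrow> nat \<Rightarrow> nat" where
  "part l i = l ! (i - 1)"

definition conj_part :: "nat list \<Rightarrow> nat \<Rightarrow> nat" where
  "conj_part l j = card {k \<in> {1..length l}. part l k \<ge> j}"

definition boxes :: "nat list \<Rightarrow> (nat \<times> nat) set" where
  "boxes l = (SIGMA i:{1..length l}. {1..part l i})"

text \<open>
  For a box \<open>(i, j)\<close> of a partition, \<open>j \<le> part l i\<close> and \<open>i \<le> conj_part l j\<close>, so neither natural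
  number subtraction truncates.
\<close>

definition hook_length :: "nat list \<Rightarrow> nat \<times> nat \<Rightarrow> nat" where
  "hook_length l = (\<lambda>(i, j). (part l i - j) + (conj_part l j - i) + 1)"

definition box_content :: "nat \<times> nat \<Rightarrow> int" where
  "box_content = (\<lambda>(i, j). int j - int i)"

definition b_stat :: "nat list \<Rightarrow> nat" where
  "b_stat l = (\<Sum>i = 1..length l. (i - 1) * part l i)"

lemma no_truncation_in_hook_length:
  assumes "l \<in> partitions" "(i, j) \<in> boxes l"
  shows "j \<le> part l i" "i \<le> conj_part l j"
proof -
  show j: "j \<le> part l i" using assms by (auto simp: boxes_def)
  have i: "1 \<le> i" "i \<le> length l" using assms by (auto simp: boxes_def)
  have "j \<le> part l k" if "k \<in> {1..i}" for k
  proof (cases "k = i")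
    case False
    then have "l ! (k - 1) \<ge> l ! (i - 1)"
      using that i assms(1) by (auto simp: partitions_def intro!: sorted_wrt_nth_less[of "(\<ge>)"])
    then show ?thesis using j by (simp add: part_def)
  qed (use j in simp)
  then have "{1..i} \<subseteq> {k \<in> {1..length l}. part l k \<ge> j}" using i by auto
  then have "card {1..i} \<le> conj_part l j" unfolding conj_part_def by (intro card_mono) auto
  then show "i \<le> conj_part l j" by simp
qed

end

theory Submission
  imports Defs "Jordan_Normal_Form.Determinant"
begin

text \<open>
  Both sides are \<open>\<Prod>k. (1 - x ^ k) powr (\<beta> - 1)\<close>. Every coefficient is a polynomial in \<open>\<beta>\<close>, so each side
  need only be evaluated at infinitely many \<open>\<beta>\<close>.

  At \<open>\<beta> = 1 - n\<close> the left-hand side is \<open>\<Sum>\<lambda>. s\<^sub>\<lambda>(x, x\<^sup>2, \<dots>) s\<^sub>\<lambda>(1, \<dots>, 1)\<close> with \<open>n\<close> ones,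
  supported on partitions with at most \<open>n\<close> rows. Both Schur functions are \<open>n \<times> n\<close> determinants of
  Vandermonde type, and the Cauchy--Binet formula sums their products.

  At \<open>\<beta> = m\<^sup>2\<close> a Cauchy determinant gives
  \<open>\<Prod>v\<in>\<lambda>. 1 - m\<^sup>2 / h\<^sub>v\<^sup>2 = \<Sum>\<mu>. s\<^bsub>\<lambda>/\<mu>\<^esub>[m] s\<^bsub>\<lambda>/\<mu>\<^esub>[- m]\<close>. Hence the right-hand side is the
  trace of \<open>x ^ size\<close> times \<open>m\<close> operators that add a horizontal strip and \<open>m\<close> signed operators that
  remove a vertical strip. Cyclicity of the trace and the commutation rule of these operators evaluate it.
\<close>

section \<open>Determinants\<close>

text \<open>The obstacle is finiteness: adding strips leads out of every finite set of shapes. The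
  argument therefore runs modulo \<open>x ^ (N + 1)\<close>, with shapes cut at size
  \<open>N\<close>, and operators are compared only after multiplication by \<open>x\<close> to the
  size of the index on the right, which makes the cut invisible. Squares appear since the Cauchy
  matrix at \<open>m\<close> pairs each difference \<open>D\<close> of encoded rows with the factors
  \<open>1 + m / D\<close> and \<open>1 - m / D\<close>; a natural \<open>m\<close> is needed so
  that the determinants compose from \<open>m\<close> elementary strips. Each turn around the trace
  multiplies the weight of an added box by \<open>x\<close>, so after \<open>N\<close> turns only
  the diagonal is left modulo \<open>x ^ (N + 1)\<close>. On the left, the \<open>n\<close>
  coinciding variables make the Cauchy matrix confluent: binomial coefficients replace powers. The
  infinite product is never formed. The coefficient of \<open>x ^ N\<close> on both sides is
  compared with that of the power \<open>\<beta> - 1\<close> of the product of the first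
  \<open>N\<close> factors, as later factors do not reach it.\<close>

definition fdet :: "nat \<Rightarrow> (nat \<Rightarrow> nat \<Rightarrow> 'a::comm_ring_1) \<Rightarrow> 'a" where
  "fdet n f = det (mat n n (\<lambda>(i, j). f i j))"

lemma fdet_perm: "fdet n f = (\<Sum>p | p permutes {..<n}. signof p * (\<Prod>i<n. f i (p i)))"
proof -
  have "fdet n f = (\<Sum>p | p permutes {0..<n}. signof p *
      (\<Prod>i = 0..<n. mat n n (\<lambda>(i, j). f i j) $$ (i, p i)))"
    unfolding fdet_def by (rule det_def') simp
  also have "\<dots> = (\<Sum>p | p permutes {0..<n}. signof p * (\<Prod>i = 0..<n. f i (p i)))"
  proof (intro sum.cong refl arg_cong2[of _ _ _ _ "(*)"] prod.cong)
    fix p i assume "p \<in> {p. p permutes {0..<n}}" "i \<in> {0..<n}"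
    then show "mat n n (\<lambda>(i, j). f i j) $$ (i, p i) = f i (p i)"
      using permutes_in_image[of p "{0..<n}" i] by simp
  qed
  finally show ?thesis by (simp add: lessThan_atLeast0)
qed

lemma fdet_cong: "(\<And>i j. i < n \<Longrightarrow> j < n \<Longrightarrow> f i j = g i j) \<Longrightarrow> fdet n f = fdet n g"
  unfolding fdet_def by (intro arg_cong[of _ _ det] eq_matI) auto

lemma fdet_mult: "fdet n f * fdet n g = fdet n (\<lambda>i j. \<Sum>k<n. f i k * g k j)"
  unfolding fdet_def
  by (subst det_mult[symmetric, where n = n])
     (auto intro!: arg_cong[of _ _ det] eq_matI simp: scalar_prod_def lessThan_atLeast0)

lemma fdet_transpose: "fdet n (\<lambda>i j. f j i) = fdet n f"
proof -
  have "mat n n (\<lambda>(i, j). f j i) = transpose_mat (mat n n (\<lambda>(i, j). f i j))"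
    by (intro eq_matI) auto
  then show ?thesis unfolding fdet_def by (simp add: det_transpose[where n = n])
qed

lemma fdet_upper_triangular:
  assumes "\<And>i j. j < i \<Longrightarrow> i < n \<Longrightarrow> f i j = 0"
  shows "fdet n f = (\<Prod>i<n. f i i)"
proof -
  have "fdet n f = prod_list (diag_mat (mat n n (\<lambda>(i, j). f i j)))"
    unfolding fdet_def by (rule det_upper_triangular[where n = n]) (use assms in auto)
  also have "\<dots> = (\<Prod>i<n. f i i)"
    by (subst prod.list_conv_set_nth) (auto simp: diag_mat_def lessThan_atLeast0 intro!: prod.cong)
  finally show ?thesis .
qed

lemma fdet_lower_triangular:
  assumes "\<And>i j. i < j \<Longrightarrow> j < n \<Longrightarrow> f i j = 0"
  shows "fdet n f = (\<Prod>i<n. f i i)"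
  using fdet_upper_triangular[of n "\<lambda>i j. f j i"] assms
    by (simp add: fdet_transpose[of n f, symmetric])

lemma fdet_scale: "fdet n (\<lambda>i j. r i * f i j * c j) = (\<Prod>i<n. r i) * (\<Prod>j<n. c j) * fdet n f"
proof -
  have "signof p * (\<Prod>i<n. r i * f i (p i) * c (p i))
      = (\<Prod>i<n. r i) * (\<Prod>j<n. c j) * (signof p * (\<Prod>i<n. f i (p i)))"
    if "p permutes {..<n}" for p
    using prod.permute[OF that, of c] by (simp add: prod.distrib o_def mult_ac)
  then show ?thesis unfolding fdet_perm sum_distrib_left by (intro sum.cong) auto
qed

lemma fdet_identical_rows:
  assumes "i < n" "j < n" "i \<noteq> j" "\<And>k. k < n \<Longrightarrow> f i k = f j k"
  shows "fdet n f = 0"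
  unfolding fdet_def
  by (rule det_identical_rows[where n = n and i = i and j = j]) (use assms in \<open>auto intro!: eq_vecI\<close>)

lemma fdet_permute_rows:
  assumes "p permutes {..<n}"
  shows "fdet n (\<lambda>i j. f (p i) j) = signof p * fdet n f"
proof -
  have "mat n n (\<lambda>(i, j). f (p i) j) = mat n n (\<lambda>(i, j). mat n n (\<lambda>(i, j). f i j) $$ (p i, j))"
    using permutes_in_image[OF assms] by (intro eq_matI) auto
  then show ?thesis
    unfolding fdet_def using det_permute_rows[of "mat n n (\<lambda>(i, j). f i j)" n p] assms
    by (simp add: lessThan_atLeast0)
qed

section \<open>Strictly decreasing sequences and the Cauchy--Binet formula\<close>

text \<open>These sequences index the \<open>n\<close>-element subsets of \<open>A\<close>. The
  extensional function space makes a sequence equal to another as soon as their first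
  \<open>n\<close> values agree.\<close>

definition sdec :: "nat \<Rightarrow> nat set \<Rightarrow> (nat \<Rightarrow> nat) set" where
  "sdec n A = {L \<in> {..<n} \<rightarrow>\<^sub>E A. \<forall>i j. i < j \<and> j < n \<longrightarrow> L j < L i}"

lemma finite_sdec [simp]: "finite A \<Longrightarrow> finite (sdec n A)"
  unfolding sdec_def by (rule finite_subset[of _ "{..<n} \<rightarrow>\<^sub>E A"]) (auto intro: finite_PiE)

lemma sdec_less: "L \<in> sdec n A \<Longrightarrow> i < j \<Longrightarrow> j < n \<Longrightarrow> L j < L i"
  by (auto simp: sdec_def)

lemma sdec_le: "L \<in> sdec n A \<Longrightarrow> i \<le> j \<Longrightarrow> j < n \<Longrightarrow> L j \<le> L i"
  using sdec_less[of L n A i j] by (cases "i = j") auto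

lemma sdec_gap:
  assumes "L \<in> sdec n A" "i \<le> j" "j < n"
  shows "L j + (j - i) \<le> L i"
  using assms(2,3)
proof (induction j)
  case (Suc j)
  then show ?case
    using sdec_less[OF assms(1), of j "Suc j"] by (cases "i = Suc j") (auto simp: Suc_diff_le)
qed auto

lemma sdec_mem: "L \<in> sdec n A \<Longrightarrow> i < n \<Longrightarrow> L i \<in> A"
  by (auto simp: sdec_def)

lemma sdec_mono: "A \<subseteq> B \<Longrightarrow> sdec n A \<subseteq> sdec n B"
  by (auto simp: sdec_def)

lemma sdec_inj_on: "L \<in> sdec n A \<Longrightarrow> inj_on L {..<n}"
  by (rule inj_onI) (metis lessThan_iff linorder_neqE_nat order_less_irrefl sdec_less)

lemma sdec_ext: "L \<in> sdec n A \<Longrightarrow> M \<in> sdec n B \<Longrightarrow> (\<And>i. i < n \<Longrightarrow> L i = M i) \<Longrightarrow> L = M"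
  by (auto simp: sdec_def intro!: PiE_ext[of L "{..<n}" _ M])

lemma sdec_list:
  assumes "L \<in> sdec n A"
  shows "rev (map L [0..<n]) = sorted_list_of_set (L ` {..<n})"
proof (rule strict_sorted_equal)
  show "sorted_wrt (<) (rev (map L [0..<n]))"
    unfolding sorted_wrt_rev by (simp add: sorted_wrt_iff_nth_less sdec_less[OF assms])
qed (auto simp: lessThan_atLeast0)

lemma sdec_unique:
  assumes "L \<in> sdec n A" "M \<in> sdec n B" "L ` {..<n} = M ` {..<n}"
  shows "L = M"
proof (rule sdec_ext[OF assms(1,2)])
  have "map L [0..<n] = map M [0..<n]"
    using sdec_list[OF assms(1)] sdec_list[OF assms(2)] assms(3) by (metis rev_rev_ident)
  then show "L i = M i" if "i < n" for i using that by (simp add: list_eq_iff_nth_eq)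
qed

lemma sdec_exists:
  assumes "finite S" "card S = n" "S \<subseteq> A"
  shows "\<exists>L \<in> sdec n A. L ` {..<n} = S"
proof
  let ?xs = "rev (sorted_list_of_set S)"
  have len: "length ?xs = n" using assms by simp
  have dec: "sorted_wrt (>) ?xs" using strict_sorted_list_of_set[of S] by (simp add: sorted_wrt_rev)
  show img: "restrict ((!) ?xs) {..<n} ` {..<n} = S"
    using len assms(1) by (metis image_restrict_eq lessThan_atLeast0 nth_image order_refl set_rev
        set_sorted_list_of_set take_all)
  show "restrict ((!) ?xs) {..<n} \<in> sdec n A"
    unfolding sdec_def using len dec assms(3) img by (auto simp: sorted_wrt_iff_nth_less)
qed

text \<open>Sorting: the image of an injective map determines \<open>L\<close>, and injectivity of
  \<open>L\<close> then determines \<open>p\<close>.\<close>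

lemma bij_betw_sdec_perm:
  "bij_betw (\<lambda>(L, p). restrict (L \<circ> p) {..<n}) (sdec n A \<times> {p. p permutes {..<n}})
     {g \<in> {..<n} \<rightarrow>\<^sub>E A. inj_on g {..<n}}"
proof (rule bij_betwI')
  fix x y assume x: "x \<in> sdec n A \<times> {p. p permutes {..<n}}" and y: "y \<in> sdec n A \<times> {p. p permutes {..<n}}"
  obtain L p M q where xy: "x = (L, p)" "y = (M, q)" by fastforce
  have L: "L \<in> sdec n A" "M \<in> sdec n A" and p: "p permutes {..<n}" "q permutes {..<n}"
    using x y xy by auto
  have "L = M \<and> p = q" if eq: "restrict (L \<circ> p) {..<n} = restrict (M \<circ> q) {..<n}"
  proof -
    have *: "L (p i) = M (q i)" if "i < n" for i
      using fun_cong[OF eq, of i] that by simp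
    have "L ` {..<n} = (L \<circ> p) ` {..<n}"
      by (simp only: image_comp[symmetric] permutes_image[OF p(1)])
    also have "\<dots> = (M \<circ> q) ` {..<n}" using * by (intro image_cong) auto
    also have "\<dots> = M ` {..<n}"
      by (simp only: image_comp[symmetric] permutes_image[OF p(2)])
    finally have LM: "L = M" by (rule sdec_unique[OF L])
    have "p i = q i" if "i < n" for i
      using *[OF that] sdec_inj_on[OF L(1)] permutes_in_image[OF p(1), of i]
        permutes_in_image[OF p(2), of i] that LM by (auto dest!: inj_onD)
    moreover have "p i = q i" if "\<not> i < n" for i
      using that p by (metis lessThan_iff permutes_not_in)
    ultimately show ?thesis using LM by blast
  qed
  then show "((case x of (L, p) \<Rightarrow> restrict (L \<circ> p) {..<n})
      = (case y of (L, p) \<Rightarrow> restrict (L \<circ> p) {..<n})) = (x = y)"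
    using xy by auto
next
  fix x assume "x \<in> sdec n A \<times> {p. p permutes {..<n}}"
  then obtain L p where x: "x = (L, p)" "L \<in> sdec n A" "p permutes {..<n}" by auto
  have "inj_on (L \<circ> p) {..<n}"
    using x sdec_inj_on[OF x(2)] by (intro comp_inj_on) (auto simp: permutes_image permutes_inj_on)
  moreover have "L (p i) \<in> A" if "i < n" for i
    using sdec_mem[OF x(2)] permutes_in_image[OF x(3), of i] that by simp
  ultimately show "(case x of (L, p) \<Rightarrow> restrict (L \<circ> p) {..<n}) \<in> {g \<in> {..<n} \<rightarrow>\<^sub>E A. inj_on g {..<n}}"
    using x(1) by (auto simp: inj_on_def)
next
  fix g assume "g \<in> {g \<in> {..<n} \<rightarrow>\<^sub>E A. inj_on g {..<n}}"
  then have g: "g \<in> {..<n} \<rightarrow>\<^sub>E A" "inj_on g {..<n}" by auto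
  obtain L where L: "L \<in> sdec n A" "L ` {..<n} = g ` {..<n}"
    using sdec_exists[of "g ` {..<n}" n A] g by (auto simp: card_image)
  define p where "p i = (if i < n then the_inv_into {..<n} L (g i) else i)" for i
  have Lp: "L (p i) = g i \<and> p i < n" if "i < n" for i
    using that L(2) sdec_inj_on[OF L(1)]
    by (simp add: p_def f_the_inv_into_f the_inv_into_into[of L "{..<n}" "g i" "{..<n}", simplified])
  have "p permutes {..<n}"
  proof (rule bij_imp_permutes)
    have "inj_on p {..<n}" using g(2) Lp by (intro inj_onI) (metis inj_onD lessThan_iff)
    then show "bij_betw p {..<n} {..<n}"
      using Lp by (intro bij_betw_imageI endo_inj_surj) auto
  qed (auto simp: p_def)
  moreover have "g = restrict (L \<circ> p) {..<n}"
  proof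
    show "g i = restrict (L \<circ> p) {..<n} i" for i
      using Lp[of i] PiE_arb[OF g(1), of i] by (cases "i < n") simp_all
  qed
  ultimately show "\<exists>x\<in>sdec n A \<times> {p. p permutes {..<n}}. g
      = (case x of (L, p) \<Rightarrow> restrict (L \<circ> p) {..<n})"
    using L(1) by auto
qed

text \<open>The product of row sums is expanded over all maps \<open>g\<close>. A repeated value
  gives two equal rows; the injective maps are grouped by their sorted image, and reordering the
  rows of \<open>b\<close> yields the sign that completes the first determinant.\<close>

theorem cauchy_binet:
  assumes "finite A"
  shows "(\<Sum>L\<in>sdec n A. fdet n (\<lambda>i k. a i (L k)) * fdet n (\<lambda>k j. b (L k) j))
    = fdet n (\<lambda>i j. \<Sum>l\<in>A. a i l * b l j)"
proof -
  let ?P = "{p. p permutes {..<n}}" and ?F = "\<lambda>g. (\<Prod>i<n. a i (g i)) * fdet n (\<lambda>i j. b (g i) j)"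
  have "fdet n (\<lambda>i j. \<Sum>l\<in>A. a i l * b l j)
      = (\<Sum>p\<in>?P. \<Sum>g\<in>{..<n} \<rightarrow>\<^sub>E A. signof p * (\<Prod>i<n. a i (g i) * b (g i) (p i)))"
    unfolding fdet_perm using assms by (simp add: prod_sum_PiE sum_distrib_left)
  also have "\<dots> = (\<Sum>g\<in>{..<n} \<rightarrow>\<^sub>E A. ?F g)"
    by (subst sum.swap) (simp add: fdet_perm prod.distrib sum_distrib_left mult_ac)
  also have "\<dots> = (\<Sum>g\<in>{g \<in> {..<n} \<rightarrow>\<^sub>E A. inj_on g {..<n}}. ?F g)"
  proof (rule sum.mono_neutral_right)
    show "\<forall>g\<in>({..<n} \<rightarrow>\<^sub>E A) - {g \<in> {..<n} \<rightarrow>\<^sub>E A. inj_on g {..<n}}. ?F g = 0"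
    proof
      fix g assume "g \<in> ({..<n} \<rightarrow>\<^sub>E A) - {g \<in> {..<n} \<rightarrow>\<^sub>E A. inj_on g {..<n}}"
      then obtain i j where "i < n" "j < n" "i \<noteq> j" "g i = g j" by (auto simp: inj_on_def)
      then have "fdet n (\<lambda>i j. b (g i) j) = 0" by (intro fdet_identical_rows[of i n j]) auto
      then show "?F g = 0" by simp
    qed
  qed (use assms in \<open>auto intro: finite_PiE\<close>)
  also have "\<dots> = (\<Sum>x\<in>sdec n A \<times> ?P. ?F (case x of (L, p) \<Rightarrow> restrict (L \<circ> p) {..<n}))"
    by (rule sum.reindex_bij_betw[OF bij_betw_sdec_perm, symmetric])
  also have "\<dots> = (\<Sum>L\<in>sdec n A. \<Sum>p\<in>?P. ?F (restrict (L \<circ> p) {..<n}))"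
    by (simp add: sum.cartesian_product split_def)
  also have "\<dots> = (\<Sum>L\<in>sdec n A. fdet n (\<lambda>i k. a i (L k)) * fdet n (\<lambda>k j. b (L k) j))"
  proof (rule sum.cong[OF refl])
    fix L
    have "?F (restrict (L \<circ> p) {..<n}) = signof p * (\<Prod>i<n. a i (L (p i)))
        * fdet n (\<lambda>k j. b (L k) j)"
      if "p \<in> ?P" for p
    proof -
      have "fdet n (\<lambda>i j. b (restrict (L \<circ> p) {..<n} i) j) = fdet n (\<lambda>i j. b (L (p i)) j)"
        by (rule fdet_cong) simp
      also have "\<dots> = signof p * fdet n (\<lambda>k j. b (L k) j)"
        using fdet_permute_rows[of p n "\<lambda>i j. b (L i) j"] that by simp
      finally show ?thesis by (simp add: mult_ac)
    qed
    then show "(\<Sum>p\<in>?P. ?F (restrict (L \<circ> p) {..<n}))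
        = fdet n (\<lambda>i k. a i (L k)) * fdet n (\<lambda>k j. b (L k) j)"
      by (simp add: fdet_perm[of n "\<lambda>i k. a i (L k)"] sum_distrib_right)
  qed
  finally show ?thesis by simp
qed

text \<open>The matrix of values is the matrix of powers of the points times the matrix of
  coefficients.\<close>

lemma fdet_poly:
  fixes p :: "nat \<Rightarrow> 'a::comm_ring_1 poly"
  assumes "\<And>j. j < n \<Longrightarrow> degree (p j) < n"
  shows "fdet n (\<lambda>i j. poly (p j) (t i)) = fdet n (\<lambda>i k. t i ^ k) * fdet n (\<lambda>k j. coeff (p j) k)"
proof -
  have "poly (p j) x = (\<Sum>k<n. x ^ k * coeff (p j) k)" if "j < n" for j x
  proof -
    have "poly (p j) x = (\<Sum>k\<le>degree (p j). x ^ k * coeff (p j) k)"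
      by (simp add: poly_altdef mult.commute)
    also have "\<dots> = (\<Sum>k<n. x ^ k * coeff (p j) k)"
      using assms[OF that] by (intro sum.mono_neutral_left) (auto simp: coeff_eq_0)
    finally show ?thesis .
  qed
  then show ?thesis unfolding fdet_mult by (intro fdet_cong) simp
qed

lemma fdet_poly_triangular:
  fixes p :: "nat \<Rightarrow> 'a::comm_ring_1 poly"
  assumes "\<And>j. j < n \<Longrightarrow> degree (p j) \<le> j"
  shows "fdet n (\<lambda>i j. poly (p j) (t i)) = fdet n (\<lambda>i k. t i ^ k) * (\<Prod>j<n. coeff (p j) j)"
proof -
  have "fdet n (\<lambda>k j. coeff (p j) k) = (\<Prod>j<n. coeff (p j) j)"
    using assms by (intro fdet_upper_triangular) (metis coeff_eq_0 le_less_trans less_trans)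
  moreover have "degree (p j) < n" if "j < n" for j using assms[OF that] that by simp
  ultimately show ?thesis by (simp add: fdet_poly)
qed

lemma degree_prod_linear: "finite A \<Longrightarrow> degree (\<Prod>r\<in>A. [:c r, 1::'a::comm_ring_1:]) \<le> card A"
proof (induction A rule: finite_induct)
  case (insert x F)
  have "degree ([:c x, 1:] * (\<Prod>r\<in>F. [:c r, 1:])) \<le> degree [:c x, 1:] + degree (\<Prod>r\<in>F. [:c r, 1:])"
    by (rule degree_mult_le)
  also have "\<dots> \<le> 1 + card F" using insert by (intro add_mono) auto
  finally show ?case using insert by simp
qed simp

lemma coeff_prod_linear: "finite A \<Longrightarrow> coeff (\<Prod>r\<in>A. [:c r, 1::'a::comm_ring_1:]) (card A) = 1"
proof (induction A rule: finite_induct)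
  case (insert x F)
  have "coeff (\<Prod>r\<in>F. [:c r, 1:]) (Suc (card F)) = 0"
    using degree_prod_linear[OF insert(1), of c] by (intro coeff_eq_0) simp
  then show ?case using insert by simp
qed simp

text \<open>Newton's basis: the polynomials \<open>?p j\<close> are monic of degree
  \<open>j\<close>, so they do not change the determinant, and \<open>?p j\<close> vanishes at
  \<open>t i\<close> for \<open>i < j\<close>, so the matrix of values is triangular.\<close>

theorem vandermonde: "fdet n (\<lambda>i k. t i ^ k) = (\<Prod>j<n. \<Prod>i<j. t j - t i)"
proof -
  let ?p = "\<lambda>j. \<Prod>r<j. [:- t r, 1:]"
  have "fdet n (\<lambda>i j. poly (?p j) (t i)) = fdet n (\<lambda>i k. t i ^ k)"
    using degree_prod_linear[of "{..<_}" "\<lambda>r. - t r"] coeff_prod_linear[of "{..<_}" "\<lambda>r. - t r"]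
    by (subst fdet_poly_triangular) auto
  moreover have "fdet n (\<lambda>i j. poly (?p j) (t i)) = (\<Prod>j<n. poly (?p j) (t j))"
    by (rule fdet_lower_triangular) (auto simp: poly_prod intro!: prod_zero)
  ultimately show ?thesis by (simp add: poly_prod)
qed

text \<open>The coefficient matrix of the polynomials \<open>\<Prod>k\<noteq>j. (X + y k)\<close> need not be computed: its
  determinant is read off at the points \<open>- y i\<close>, where the matrix of values is diagonal.\<close>

lemma fdet_cauchy:
  fixes x y :: "nat \<Rightarrow> 'a::comm_ring_1"
  shows "fdet n (\<lambda>i j. \<Prod>k\<in>{..<n} - {j}. x i + y k) * fdet n (\<lambda>i k. (- y i) ^ k)
    = fdet n (\<lambda>i k. x i ^ k) * (\<Prod>j<n. \<Prod>k\<in>{..<n} - {j}. y k - y j)"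
proof -
  let ?p = "\<lambda>j. \<Prod>k\<in>{..<n} - {j}. [:y k, 1:]" 
  have deg: "degree (?p j) < n" if "j < n" for j
    using degree_prod_linear[of "{..<n} - {j}" y] that by simp
  define C where "C = fdet n (\<lambda>k j. coeff (?p j) k)"
  have 1: "fdet n (\<lambda>i j. poly (?p j) (- y i)) = (\<Prod>j<n. poly (?p j) (- y j))"
    by (rule fdet_lower_triangular) (auto simp: poly_prod intro!: prod_zero)
  have 2: "fdet n (\<lambda>i j. poly (?p j) (s i)) = fdet n (\<lambda>i k. s i ^ k) * C" for s
    unfolding C_def by (rule fdet_poly) (rule deg)
  have 3: "fdet n (\<lambda>i k. (- y i) ^ k) * C = (\<Prod>j<n. poly (?p j) (- y j))"
    using 1 2[of "\<lambda>i. - y i"] by simp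
  have "fdet n (\<lambda>i j. poly (?p j) (x i)) * fdet n (\<lambda>i k. (- y i) ^ k)
      = fdet n (\<lambda>i k. x i ^ k) * (fdet n (\<lambda>i k. (- y i) ^ k) * C)"
    unfolding 2[of x] by (simp only: mult_ac)
  then show ?thesis unfolding 3 by (simp add: poly_prod add.commute)
qed

section \<open>The Cauchy matrix of binomial sums\<close>

text \<open>For a natural number \<open>m\<close>, \<open>hh m L M\<close> is the complete symmetric function of degree \<open>L - M\<close> in
  \<open>m\<close> variables equal to 1, and \<open>ee m L M\<close> is, up to the sign, the elementary one. The determinants of
  \<open>hh m (L i) (M j)\<close> and \<open>ee m (L i) (M j)\<close> are thus skew Schur functions (Jacobi--Trudi).\<close>

definition hh :: "complex \<Rightarrow> nat \<Rightarrow> nat \<Rightarrow> complex" where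
  "hh m L M = (if M \<le> L then (m + of_nat (L - M) - 1) gchoose (L - M) else 0)"

definition ee :: "complex \<Rightarrow> nat \<Rightarrow> nat \<Rightarrow> complex" where
  "ee m L M = (if M \<le> L then (- 1) ^ (L - M) * (m gchoose (L - M)) else 0)"

lemma hh_Suc_Suc [simp]: "hh m (Suc L) (Suc M) = hh m L M"
  and ee_Suc_Suc [simp]: "ee m (Suc L) (Suc M) = ee m L M"
  by (simp_all add: hh_def ee_def)

lemma hh_one: "hh 1 L M = (if M \<le> L then 1 else 0)"
  using binomial_gbinomial[of "L - M" "L - M", where ?'a = complex]
    by (simp add: hh_def del: of_nat_diff)

text \<open>Coefficients of \<open>(1 - u)^(-1) (1 - u)^(-m) = (1 - u)^(-(m + 1))\<close>; the bound
  \<open>B\<close> loses no nonzero term.\<close>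

lemma hh_compose:
  assumes "L \<le> B"
  shows "(\<Sum>l\<le>B. hh 1 L l * hh m l M) = hh (m + 1) L M"
proof (cases "M \<le> L")
  case True
  have "(\<Sum>l\<le>B. hh 1 L l * hh m l M) = (\<Sum>l = M..L. (m - 1 + of_nat (l - M)) gchoose (l - M))"
    using assms
      by (intro sum.mono_neutral_cong_right, auto simp: hh_one) (auto simp: hh_def algebra_simps)
  also have "\<dots> = (\<Sum>k\<le>L - M. (m - 1 + of_nat k) gchoose k)"
    using True by (intro sum.reindex_bij_witness[of _ "\<lambda>k. k + M" "\<lambda>l. l - M"]) auto
  also have "\<dots> = hh (m + 1) L M"
    using True gbinomial_parallel_sum[of "m - 1" "L - M"] by (simp add: hh_def algebra_simps)
  finally show ?thesis .
next
  case False
  then have "hh 1 L l * hh m l M = 0" for l by (auto simp: hh_def)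
  then have "(\<Sum>l\<le>B. hh 1 L l * hh m l M) = 0" by (simp only: sum.neutral_const)
  then show ?thesis using False by (simp add: hh_def)
qed

lemma ee_one: "ee 1 L M = (if L = M then 1 else if L = Suc M then - 1 else 0)"
proof -
  have "(1::complex) gchoose k = 0" if "k \<ge> 2" for k
    using binomial_gbinomial[of 1 k, where ?'a = complex] that by (simp add: binomial_eq_0)
  moreover consider "L < M" | "L = M" | "L = Suc M" | "L - M \<ge> 2" by linarith
  ultimately show ?thesis by cases (auto simp: ee_def)
qed

text \<open>Coefficients of \<open>(1 - u) (1 - u)^m = (1 - u)^(m + 1)\<close>.\<close>

lemma ee_compose:
  assumes "L \<le> B"
  shows "(\<Sum>l\<le>B. ee 1 L l * ee m l M) = ee (m + 1) L M"
proof (cases L)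
  case 0
  then have "(\<Sum>l\<le>B. ee 1 L l * ee m l M) = (\<Sum>l\<in>{0}. ee 1 L l * ee m l M)"
    by (intro sum.mono_neutral_right) (auto simp: ee_one)
  then show ?thesis using 0 by (simp add: ee_one) (simp add: ee_def)
next
  case (Suc K)
  then have "(\<Sum>l\<le>B. ee 1 L l * ee m l M) = (\<Sum>l\<in>{K, Suc K}. ee 1 L l * ee m l M)"
    using assms by (intro sum.mono_neutral_right) (auto simp: ee_one)
  also have "\<dots> = ee m L M - ee m K M" using Suc by (simp add: ee_one)
  also have "\<dots> = ee (m + 1) L M"
  proof (cases "M \<le> K")
    case True
    then show ?thesis using Suc gbinomial_Suc_Suc[of m "K - M"]
      by (simp add: ee_def Suc_diff_le algebra_simps)
  qed (use Suc in \<open>auto simp: ee_def le_Suc_eq\<close>)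
  finally show ?thesis .
qed

text \<open>This and \<open>ee_step\<close> compare coefficients in the derivatives of
  \<open>(1 - u)^(-m)\<close> and \<open>(1 - v)^m\<close>.\<close>

lemma hh_step: "of_nat (Suc L) * hh m (Suc L) 0 = m * ((m + of_nat L) gchoose L)"
  using gbinomial_mult_1[of "m + of_nat L" L] by (simp add: hh_def algebra_simps)

lemma ee_step: "of_nat (Suc K) * ee m (Suc K) 0 = - m * ((- 1) ^ K * ((m - 1) gchoose K))"
  using gbinomial_absorption[of K m] by (simp add: ee_def algebra_simps del: of_nat_Suc)

text \<open>This and the next lemma are the coefficients of
  \<open>(1 - u) (1 - u)^(-m - 1) = (1 - u)^(-m)\<close> and
  \<open>(1 - v) (1 - v)^(m - 1) = (1 - v)^m\<close>.\<close>

lemma gchoose_shift_Suc: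
  "(m + of_nat (Suc L)) gchoose Suc L = ((m + of_nat L) gchoose L) + hh m (Suc L) 0"
  using gbinomial_Suc_Suc[of "m + of_nat L" L] by (simp add: hh_def algebra_simps)

lemma alternating_gchoose_Suc:
  "(- 1) ^ Suc K * ((m - 1) gchoose Suc K) = (- 1) ^ K * ((m - 1) gchoose K) + ee m (Suc K) 0"
  using gbinomial_Suc_Suc[of "m - 1" K] by (simp add: ee_def algebra_simps)

text \<open>Both factors depend only on differences of their arguments, so splitting off
  \<open>l = 0\<close> leaves the same sum one step lower. This is the factor
  \<open>1 / (1 - u v)\<close> of the generating function.\<close>

lemma sum_hh_ee_Suc:
  "(\<Sum>l\<le>Suc B. hh m (Suc L) l * ee m (Suc K) l)
    = hh m (Suc L) 0 * ee m (Suc K) 0 + (\<Sum>l\<le>B. hh m L l * ee m K l)"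
  unfolding sum.atMost_Suc_shift by simp

text \<open>The generating function \<open>((1 - v) / (1 - u)) ^ m / (1 - u v)\<close> of these sums is, up to the factor
  \<open>L - K + m\<close> on its coefficients, a product of a series in \<open>u\<close> and one in \<open>v\<close>; so the matrix of
  sums is of Cauchy type.\<close>

lemma sum_hh_ee:
  assumes "L \<le> B" "K \<le> B"
  shows "(of_nat L - of_nat K + m) * (\<Sum>l\<le>B. hh m L l * ee m K l)
    = m * ((m + of_nat L) gchoose L) * ((- 1) ^ K * ((m - 1) gchoose K))"
  using assms
proof (induction L arbitrary: K B)
  case 0
  have "(\<Sum>l\<le>B. hh m 0 l * ee m K l) = (\<Sum>l\<in>{0}. hh m 0 l * ee m K l)"
    by (intro sum.mono_neutral_right) (auto simp: hh_def)
  also have "\<dots> = (- 1) ^ K * (m gchoose K)" by (simp add: hh_def ee_def)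
  finally show ?case using gbinomial_absorb_comp[of m K] by (simp add: mult.left_commute)
next
  case (Suc L)
  show ?case
  proof (cases K)
    case 0
    have "(\<Sum>l\<le>B. hh m (Suc L) l * ee m 0 l) = (\<Sum>l\<in>{0}. hh m (Suc L) l * ee m 0 l)"
      by (intro sum.mono_neutral_right) (auto simp: ee_def)
    also have "\<dots> = (m + of_nat (Suc L) - 1) gchoose Suc L" by (simp add: hh_def ee_def)
    finally show ?thesis using 0 gbinomial_absorb_comp[of "m + of_nat (Suc L)" "Suc L"]
      by (simp add: add.commute)
  next
    case K: (Suc K')
    obtain B' where B: "B = Suc B'" using Suc.prems by (cases B) auto
    define h c e d :: complex where "h = hh m (Suc L) 0" and "c = (m + of_nat L) gchoose L"
      and "e = ee m (Suc K') 0" and "d = (- 1) ^ K' * ((m - 1) gchoose K')"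
    define S where "S = (\<Sum>l\<le>B'. hh m L l * ee m K' l)"
    have IH: "(of_nat L - of_nat K' + m) * S = m * c * d"
      unfolding S_def c_def d_def using Suc.IH[of B' K'] Suc.prems K B by simp
    have h: "of_nat (Suc L) * h = m * c" unfolding h_def c_def by (rule hh_step)
    have e: "of_nat (Suc K') * e = - m * d" unfolding e_def d_def by (rule ee_step)
    \<comment> \<open>The prefactor is distributed so that each piece meets one of the relations
      \<open>h\<close>, \<open>e\<close> and \<open>IH\<close>.\<close>
    have "(of_nat (Suc L) - of_nat (Suc K') + m) * (h * e + S)
        = of_nat (Suc L) * h * e - h * (of_nat (Suc K') * e) + m * h * e
          + (of_nat L - of_nat K' + m) * S"
      by (simp add: algebra_simps)
    also have "\<dots> = m * (c + h) * (d + e)" unfolding IH h e by (simp add: algebra_simps)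
    finally show ?thesis
      unfolding K B sum_hh_ee_Suc gchoose_shift_Suc alternating_gchoose_Suc
      by (simp only: h_def[symmetric] c_def[symmetric] e_def[symmetric] d_def[symmetric] S_def[symmetric])
  qed
qed

text \<open>Step \<open>k\<close> multiplies the two factors by \<open>1 + m / k\<close> and
  \<open>1 - m / k\<close>. The result has the shape of the right-hand side of
  \<open>hook_product\<close>.\<close>

lemma gchoose_product:
  fixes m :: complex
  shows "((m + of_nat L) gchoose L) * ((- 1) ^ L * ((m - 1) gchoose L)) = (\<Prod>k
      = 1..L. 1 - m\<^sup>2 / (of_nat k)\<^sup>2)"
proof (induction L)
  case (Suc L)
  define h c e d :: complex where "h = hh m (Suc L) 0" and "c = (m + of_nat L) gchoose L"
    and "e = ee m (Suc L) 0" and "d = (- 1) ^ L * ((m - 1) gchoose L)"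
  define N :: complex where "N = of_nat (Suc L)"
  have N: "N \<noteq> 0" unfolding N_def by (simp del: of_nat_Suc)
  have h: "h = m * c / N"
    using hh_step[of L m] N unfolding h_def c_def N_def by (simp add: field_simps)
  have e: "e = - m * d / N"
    using ee_step[of L m] N unfolding e_def d_def N_def by (simp add: field_simps)
  have "(c + h) * (d + e) = c * d * (1 - m\<^sup>2 / N\<^sup>2)"
    unfolding h e using N by (simp add: field_simps power2_eq_square)
  then show ?case
    unfolding gchoose_shift_Suc alternating_gchoose_Suc
    using Suc by (simp add: h_def c_def e_def d_def N_def)
qed simp

lemma prod_off_diagonal:
  fixes f :: "nat \<Rightarrow> nat \<Rightarrow> 'a::comm_monoid_mult"
  shows "(\<Prod>i<n. \<Prod>k\<in>{..<n} - {i}. f i k) = (\<Prod>j<n. \<Prod>i<j. f i j * f j i)"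
proof (induction n)
  case (Suc n)
  have "(\<Prod>i<n. \<Prod>k\<in>{..<Suc n} - {i}. f i k) = (\<Prod>i<n. f i n * (\<Prod>k\<in>{..<n} - {i}. f i k))"
  proof (rule prod.cong[OF refl])
    fix i assume "i \<in> {..<n}"
    then have "{..<Suc n} - {i} = insert n ({..<n} - {i})" by auto
    then show "(\<Prod>k\<in>{..<Suc n} - {i}. f i k) = f i n * (\<Prod>k\<in>{..<n} - {i}. f i k)" by simp
  qed
  moreover have "{..<Suc n} - {n} = {..<n}" by auto
  ultimately show ?case using Suc by (simp add: prod.distrib mult_ac)
qed simp

lemma vandermonde_nonzero:
  fixes t :: "nat \<Rightarrow> 'a::idom"
  assumes "\<And>i j. i < j \<Longrightarrow> j < n \<Longrightarrow> t i \<noteq> t j"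
  shows "fdet n (\<lambda>i k. t i ^ k) \<noteq> 0"
  unfolding vandermonde using assms by (auto simp: prod_zero_iff) metis

text \<open>By \<open>sum_hh_ee\<close> the entries are \<open>m * c i * d j / (x i + y j)\<close>,
  and a non-integer \<open>m\<close> keeps the denominators nonzero. For a pair of rows at distance
  \<open>D\<close> the Cauchy determinant contributes \<open>- D^2 / ((m + D) (m - D))\<close>, the
  inverse of \<open>1 - m^2 / D^2\<close>.\<close>

lemma cauchy_det_kernel:
  fixes L :: "nat \<Rightarrow> nat" and m :: complex
  assumes L: "L \<in> sdec n {..B}" and m: "m \<notin> \<int>"
  shows "fdet n (\<lambda>i j. \<Sum>l\<le>B. hh m (L i) l * ee m (L j) l)
      * (\<Prod>j<n. \<Prod>i<j. 1 - m\<^sup>2 / (of_nat (L i - L j))\<^sup>2)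
    = (\<Prod>i<n. \<Prod>k = 1..L i. 1 - m\<^sup>2 / (of_nat k)\<^sup>2)"
proof -
  define x y :: "nat \<Rightarrow> complex" where "x i = of_nat (L i) + m" and "y i = - of_nat (L i)" for i
  define c d :: "nat \<Rightarrow> complex" where "c i = (m + of_nat (L i)) gchoose L i"
    and "d i = (- 1) ^ L i * ((m - 1) gchoose L i)" for i
  define A where "A i j = (\<Sum>l\<le>B. hh m (L i) l * ee m (L j) l)" for i j
  have m0: "m \<noteq> 0" using m by auto
  have xy: "x i + y k = of_nat (L i) - of_nat (L k) + m" for i k by (simp add: x_def y_def)
  have xy_nz: "x i + y k \<noteq> 0" for i k
  proof
    assume "x i + y k = 0"
    then have "m = of_int (int (L k) - int (L i))" by (simp add: xy algebra_simps add_eq_0_iff)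
    then show False using m by (metis Ints_of_int)
  qed
  have ord: "L j < L i" if "i < j" "j < n" for i j using sdec_less[OF L that] .
  have A: "A i j * (x i + y j) = m * c i * d j" if "i < n" "j < n" for i j
    using sum_hh_ee[of "L i" B "L j" m] sdec_mem[OF L] that
    by (simp add: A_def c_def d_def xy mult_ac)
  \<comment> \<open>Row \<open>i\<close> is multiplied by all its denominators, so that no division
    occurs.\<close>
  have "fdet n A * (\<Prod>i<n. \<Prod>k<n. x i + y k) = fdet n (\<lambda>i j. (\<Prod>k<n. x i + y k) * A i j * 1)"
    unfolding fdet_scale by simp
  also have "\<dots> = fdet n (\<lambda>i j. (m * c i) * (\<Prod>k\<in>{..<n} - {j}. x i + y k) * d j)"
  proof (rule fdet_cong)
    fix i j assume ij: "i < n" "j < n"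
    have "(\<Prod>k<n. x i + y k) * A i j * 1 = (A i j * (x i + y j)) * (\<Prod>k\<in>{..<n} - {j}. x i + y k)"
      using ij prod.remove[of "{..<n}" j "\<lambda>k. x i + y k"] by (simp add: mult_ac)
    then show "(\<Prod>k<n. x i + y k) * A i j * 1 = (m * c i) * (\<Prod>k\<in>{..<n} - {j}. x i + y k) * d j"
      by (simp add: A[OF ij] mult_ac)
  qed
  also have "\<dots> = m ^ n * (\<Prod>i<n. c i * d i) * fdet n (\<lambda>i j. \<Prod>k\<in>{..<n} - {j}. x i + y k)"
    unfolding fdet_scale by (simp add: prod.distrib mult_ac)
  also have "fdet n (\<lambda>i j. \<Prod>k\<in>{..<n} - {j}. x i + y k) = (\<Prod>j<n. \<Prod>k\<in>{..<n} - {j}. y k - y j)"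
  proof -
    \<comment> \<open>The points \<open>x i\<close> and \<open>- y i\<close> differ by the constant
      \<open>m\<close>, so their Vandermonde determinants coincide and cancel in
      \<open>fdet_cauchy\<close>.\<close>
    have "fdet n (\<lambda>i k. x i ^ k) = fdet n (\<lambda>i k. (- y i) ^ k)"
      unfolding vandermonde by (simp add: x_def y_def)
    moreover have "fdet n (\<lambda>i k. (- y i) ^ k) \<noteq> 0"
      by (rule vandermonde_nonzero) (use ord in \<open>fastforce simp: y_def\<close>)
    ultimately show ?thesis using fdet_cauchy[of n x y] by (simp add: mult.commute)
  qed
  finally have 1: "fdet n A * (\<Prod>i<n. \<Prod>k<n. x i + y k)
      = m ^ n * (\<Prod>i<n. c i * d i) * (\<Prod>j<n. \<Prod>k\<in>{..<n} - {j}. y k - y j)" .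
  \<comment> \<open>The diagonal terms \<open>x i + y i = m\<close> account for the power
    \<open>m ^ n\<close>, which cancels.\<close>
  have "(\<Prod>i<n. \<Prod>k<n. x i + y k) = (\<Prod>i<n. m * (\<Prod>k\<in>{..<n} - {i}. x i + y k))"
    by (intro prod.cong) (simp_all add: prod.remove[of "{..<n}"] xy)
  then have 2: "(\<Prod>i<n. \<Prod>k<n. x i + y k) = m ^ n * (\<Prod>j<n. \<Prod>i<j. (x i + y j) * (x j + y i))"
    by (simp add: prod.distrib prod_off_diagonal)
  have 3: "(\<Prod>j<n. \<Prod>k\<in>{..<n} - {j}. y k - y j) = (\<Prod>j<n. \<Prod>i<j. (y j - y i) * (y i - y j))"
    by (rule prod_off_diagonal)
  have "(x i + y j) * (x j + y i) = (y j - y i) * (y i - y j) * (1 - m\<^sup>2 / (of_nat (L i - L j))\<^sup>2)"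
    if "i < j" "j < n" for i j
  proof -
    define D :: complex where "D = of_nat (L i - L j)"
    have "of_nat (L i) = D + (of_nat (L j) :: complex)"
      using ord[OF that] by (simp add: D_def of_nat_add[symmetric] del: of_nat_add)
    then have e: "x i + y j = m + D" "x j + y i = m - D" "y j - y i = D" "y i - y j = - D"
      by (simp_all add: x_def y_def)
    have "D \<noteq> 0" using ord[OF that] by (simp add: D_def del: of_nat_diff)
    then show ?thesis unfolding e D_def[symmetric] by (simp add: field_simps power2_eq_square)
  qed
  then have 4: "(\<Prod>j<n. \<Prod>i<j. (x i + y j) * (x j + y i)) = (\<Prod>j<n. \<Prod>i<j. (y j - y i) * (y i - y j))
      * (\<Prod>j<n. \<Prod>i<j. 1 - m\<^sup>2 / (of_nat (L i - L j))\<^sup>2)"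
    by (simp add: prod.distrib[symmetric])
  have 5: "(\<Prod>j<n. \<Prod>i<j. (y j - y i) * (y i - y j)) \<noteq> 0"
    using ord by (fastforce simp: y_def prod_zero_iff)
  have "fdet n A * (\<Prod>j<n. \<Prod>i<j. 1 - m\<^sup>2 / (of_nat (L i - L j))\<^sup>2) = (\<Prod>i<n. c i * d i)"
    using 1 5 m0 unfolding 2 3 4 by (simp add: mult_ac)
  then show ?thesis unfolding A_def c_def d_def gchoose_product .
qed

section \<open>Hooks and contents\<close>

definition pad :: "nat list \<Rightarrow> nat \<Rightarrow> nat" where
  "pad l i = (if i < length l then l ! i else 0)"

text \<open>A partition with at most \<open>n\<close> rows is encoded by the strictly decreasing sequence
  \<open>\<lambda>\<^sub>i + n - 1 - i\<close> (rows numbered from 0 here), which makes Jacobi--Trudi determinants plain minors.\<close>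

definition beta_seq :: "nat \<Rightarrow> nat list \<Rightarrow> nat \<Rightarrow> nat" where
  "beta_seq n l = (\<lambda>i\<in>{..<n}. pad l i + (n - 1 - i))"

lemma beta_seq_nth [simp]: "i < n \<Longrightarrow> beta_seq n l i = pad l i + (n - 1 - i)"
  by (simp add: beta_seq_def)

lemma pad_mono:
  assumes "l \<in> partitions" "i \<le> j"
  shows "pad l j \<le> pad l i"
  using assms by (cases "i = j") (auto simp: pad_def partitions_def sorted_wrt_iff_nth_less)

lemma pad_pos: "l \<in> partitions \<Longrightarrow> 0 < pad l i \<longleftrightarrow> i < length l"
  by (auto simp: pad_def partitions_def)

lemma beta_seq_sdec:
  assumes "l \<in> partitions"
  shows "beta_seq n l \<in> sdec n UNIV"
proof -
  have "beta_seq n l j < beta_seq n l i" if "i < j" "j < n" for i j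
    using pad_mono[OF assms, of i j] that by simp
  then show ?thesis by (auto simp: sdec_def beta_seq_def)
qed

lemma partition_eqI:
  assumes "l \<in> partitions" "l' \<in> partitions" "length l \<le> n" "length l' \<le> n"
    and "\<And>i. i < n \<Longrightarrow> pad l i = pad l' i"
  shows "l = l'"
proof -
  have "i < length l \<longleftrightarrow> i < length l'" for i
    using assms(3-5) pad_pos[OF assms(1), of i] pad_pos[OF assms(2), of i] by (cases "i < n") auto
  then have "length l = length l'" by (metis linorder_neqE_nat nat_less_le)
  moreover have "l ! i = l' ! i" if "i < length l" for i
    using assms(5)[of i] that calculation assms(3) by (simp add: pad_def)
  ultimately show ?thesis by (rule nth_equalityI)
qed

lemma bij_betw_beta: "bij_betw (beta_seq n) {l \<in> partitions. length l \<le> n} (sdec n UNIV)"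
proof (rule bij_betwI')
  fix l l' assume l: "l \<in> {l \<in> partitions. length l \<le> n}" and l': "l' \<in> {l \<in> partitions. length l \<le> n}"
  have "l = l'" if "beta_seq n l = beta_seq n l'"
  proof (rule partition_eqI[of _ _ n])
    show "pad l i = pad l' i" if "i < n" for i
      using fun_cong[OF \<open>beta_seq n l = beta_seq n l'\<close>, of i] that by simp
  qed (use l l' in auto)
  then show "(beta_seq n l = beta_seq n l') = (l = l')" by auto
next
  fix l assume "l \<in> {l \<in> partitions. length l \<le> n}"
  then show "beta_seq n l \<in> sdec n UNIV" using beta_seq_sdec by auto
next
  fix L assume L: "L \<in> sdec n UNIV"
  have dec: "L j + (j - i) \<le> L i" if "i \<le> j" "j < n" for i j
    using sdec_gap[OF L that] .
  have ge: "n - 1 - i \<le> L i" if "i < n" for i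
  proof -
    have "i \<le> n - 1" "n - 1 < n" using that by auto
    then show ?thesis using dec[of i "n - 1"] by linarith
  qed
  \<comment> \<open>The inverse of the encoding: subtract the staircase, then drop the trailing
    zeros. As \<open>f\<close> decreases weakly, its positive values occupy the first
    \<open>c\<close> places.\<close>
  define f where "f i = L i - (n - 1 - i)" for i
  have f_mono: "f j \<le> f i" if "i \<le> j" "j < n" for i j
    using dec[OF that] ge[of i] ge[of j] that unfolding f_def by simp
  define c where "c = card {i. i < n \<and> 0 < f i}"
  have "{i. i < n \<and> 0 < f i} = {..<c}"
  proof (rule ccontr)
    let ?S = "{i. i < n \<and> 0 < f i}"
    assume neq: "?S \<noteq> {..<c}"
    have down: "{..i} \<subseteq> ?S" if "i \<in> ?S" for i
      using that f_mono[of _ i] by (force simp: Suc_le_eq)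
    have "i < c" if "i \<in> ?S" for i
      using card_mono[OF _ down[OF that]] by (simp add: c_def)
    then have "?S \<subseteq> {..<c}" by auto
    then have "?S = {..<c}" by (intro card_subset_eq) (auto simp: c_def)
    with neq show False by simp
  qed
  then have c: "i < n \<and> 0 < f i \<longleftrightarrow> i < c" for i by auto
  have cn: "c \<le> n" using c by (metis leI less_irrefl)
  define l where "l = map f [0..<c]"
  have pad: "pad l i = f i" if "i < n" for i
    using c[of i] that by (auto simp: pad_def l_def)
  have "l \<in> partitions"
    using c f_mono cn by (fastforce simp: partitions_def l_def sorted_wrt_iff_nth_less)
  moreover have "length l \<le> n" using cn by (simp add: l_def)
  moreover have "L = beta_seq n l"
  proof (rule sdec_ext[OF L beta_seq_sdec[OF \<open>l \<in> partitions\<close>]])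
    show "L i = beta_seq n l i" if "i < n" for i
      unfolding beta_seq_nth[OF that] pad[OF that] f_def using ge[OF that] by simp
  qed
  ultimately show "\<exists>l\<in>{l \<in> partitions. length l \<le> n}. L = beta_seq n l" by auto
qed

lemma sum_pad:
  assumes "length l \<le> n"
  shows "(\<Sum>i<n. w i * pad l i) = (\<Sum>i<length l. w i * l ! i)"
  using assms by (intro sum.mono_neutral_cong_right) (auto simp: pad_def)

lemma sum_beta:
  assumes "length l \<le> n"
  shows "(\<Sum>i<n. beta_seq n l i) = sum_list l + (\<Sum>i<n. n - 1 - i)"
proof -
  have "(\<Sum>i<n. beta_seq n l i) = (\<Sum>i<n. pad l i + (n - 1 - i))" by (intro sum.cong) simp_all
  also have "\<dots> = (\<Sum>i<n. pad l i) + (\<Sum>i<n. n - 1 - i)" by (rule sum.distrib)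
  also have "(\<Sum>i<n. pad l i) = sum_list l"
    using sum_pad[OF assms, of "\<lambda>_. 1"] by (simp add: sum_list_sum_nth lessThan_atLeast0)
  finally show ?thesis .
qed

text \<open>The exponent of \<open>x\<close> on the left is thus the weight of giving every box in
  row \<open>i\<close>, counted from 1, the variable \<open>x ^ i\<close>.\<close>

lemma b_stat_pad:
  assumes "length l \<le> n"
  shows "sum_list l + b_stat l = (\<Sum>i<n. (i + 1) * pad l i)"
proof -
  have "b_stat l = (\<Sum>i<length l. i * l ! i)"
    unfolding b_stat_def part_def
    by (intro sum.reindex_bij_witness[of _ "\<lambda>i. i + 1" "\<lambda>i. i - 1"]) auto
  then show ?thesis unfolding sum_pad[OF assms]
    by (simp add: sum_list_sum_nth lessThan_atLeast0 sum.distrib)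
qed

text \<open>The rows of length at least \<open>j\<close> form an initial segment. Rows are counted
  from 0 here, hence the strict inequality.\<close>

lemma conj_part_iff:
  assumes "l \<in> partitions" "1 \<le> j"
  shows "k < conj_part l j \<longleftrightarrow> j \<le> pad l k"
proof -
  let ?S = "{k \<in> {1..length l}. part l k \<ge> j}"
  have mem: "Suc k \<in> ?S \<longleftrightarrow> j \<le> pad l k" for k
    using assms(2) by (auto simp: part_def pad_def)
  show ?thesis
  proof
    assume "j \<le> pad l k"
    then have le: "j \<le> pad l i" if "i \<le> k" for i using pad_mono[OF assms(1) that] by simp
    have "{1..Suc k} \<subseteq> ?S"
    proof
      fix x assume "x \<in> {1..Suc k}"
      then obtain i where i: "x = Suc i" "i \<le> k" by (cases x) auto
      show "x \<in> ?S" unfolding i(1) mem using le[OF i(2)] .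
    qed
    then have "card {1..Suc k} \<le> card ?S" by (intro card_mono) auto
    then show "k < conj_part l j" by (simp add: conj_part_def)
  next
    assume k: "k < conj_part l j"
    show "j \<le> pad l k"
    proof (rule ccontr)
      assume "\<not> j \<le> pad l k"
      then have no: "\<not> j \<le> pad l i" if "k \<le> i" for i using pad_mono[OF assms(1) that] by simp
      have "?S \<subseteq> {1..k}"
      proof
        fix x assume x: "x \<in> ?S"
        then obtain i where i: "x = Suc i" by (cases x) auto
        then have "j \<le> pad l i" using x mem by blast
        then show "x \<in> {1..k}"
          using no[of i] i
            by (metis One_nat_def Suc_leI atLeastAtMost_iff le_add1 not_le plus_1_eq_Suc)
      qed
      then have "card ?S \<le> card {1..k}" by (intro card_mono) auto
      then show False using k by (simp add: conj_part_def)
    qed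
  qed
qed

lemma conj_part_antimono: "i \<le> j \<Longrightarrow> conj_part l j \<le> conj_part l i"
  unfolding conj_part_def by (intro card_mono) auto

lemma conj_part_le_length: "conj_part l j \<le> length l"
  unfolding conj_part_def by (rule order.trans[OF card_mono[of "{1..length l}"]]) auto

text \<open>The hook lengths of row \<open>i\<close> are the elements of \<open>{1..L i}\<close> not of the form \<open>L i - L k\<close> with \<open>k > i\<close>.\<close>

lemma hook_row:
  fixes G :: "nat \<Rightarrow> 'a::comm_monoid_mult"
  assumes l: "l \<in> partitions" "length l \<le> n" and i: "i < n"
  defines "L \<equiv> beta_seq n l"
  shows "(\<Prod>j = 1..pad l i. G (hook_length l (Suc i, j))) * (\<Prod>k\<in>{i<..<n}. G (L i - L k))
    = (\<Prod>k = 1..L i. G k)"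
proof -
  define h where "h j = hook_length l (Suc i, j)" for j
  define d where "d k = L i - L k" for k
  let ?J = "{1..pad l i}" and ?K = "{i<..<n}"
  have pi: "part l (Suc i) = pad l i" if "0 < pad l i"
    using that by (auto simp: part_def pad_def split: if_splits)
  have ci: "i < conj_part l j" if "j \<in> ?J" for j
    using conj_part_iff[OF l(1), of j i] that by simp
  have h: "h j = (pad l i - j) + (conj_part l j - i)" if "j \<in> ?J" for j
    using ci[OF that] pi that by (simp add: h_def hook_length_def) arith
  have cn: "conj_part l j \<le> n" for j using conj_part_le_length[of l j] l(2) by simp
  have d: "d k = (pad l i - pad l k) + (k - i)" if "k \<in> ?K" for k
    using that i pad_mono[OF l(1), of i k] by (simp add: d_def L_def)
  have h_less: "h j' < h j" if "j \<in> ?J" "j' \<in> ?J" "j < j'" for j j'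
    using conj_part_antimono[of j j' l] that ci[OF that(1)] ci[OF that(2)] by (simp add: h)
  have h_inj: "inj_on h ?J"
    by (rule inj_onI) (metis h_less linorder_neqE_nat order_less_irrefl)
  have d_less: "d k < d k'" if "k \<in> ?K" "k' \<in> ?K" "k < k'" for k k'
    using pad_mono[OF l(1), of k k'] that by (simp add: d)
  have d_inj: "inj_on d ?K"
    by (rule inj_onI) (metis d_less linorder_neqE_nat order_less_irrefl)
  have disj: "h ` ?J \<inter> d ` ?K = {}"
  proof -
    \<comment> \<open>The hook length is larger or smaller than the difference according to whether
      the box in row \<open>k\<close> and column \<open>j\<close> belongs to the shape.\<close>
    have "h j \<noteq> d k" if j: "j \<in> ?J" and k: "k \<in> ?K" for j k
    proof (cases "k < conj_part l j")
      case True
      then have "j \<le> pad l k" using conj_part_iff[OF l(1), of j k] j by simp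
      then show ?thesis using True j k pad_mono[OF l(1), of i k] by (simp add: h d) arith
    next
      case False
      then have "pad l k < j" using conj_part_iff[OF l(1), of j k] j by simp
      then show ?thesis using False j k ci[OF j] by (simp add: h d)
    qed
    then show ?thesis by blast
  qed
  \<comment> \<open>Two disjoint injective families inside \<open>{1..L i}\<close> with
    \<open>pad l i\<close> and \<open>n - 1 - i\<close> members fill it, by counting.\<close>
  have "h ` ?J \<union> d ` ?K = {1..L i}"
  proof (rule card_subset_eq)
    show "h ` ?J \<union> d ` ?K \<subseteq> {1..L i}"
    proof -
      have "h j \<in> {1..L i}" if "j \<in> ?J" for j
        using that ci[OF that] cn[of j] i by (simp add: h L_def) arith
      moreover have "d k \<in> {1..L i}" if "k \<in> ?K" for k
        using that i by (simp add: d L_def) arith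
      ultimately show ?thesis by blast
    qed
    have "card (h ` ?J \<union> d ` ?K) = pad l i + (n - 1 - i)"
      using disj card_image[OF h_inj] card_image[OF d_inj] by (subst card_Un_disjoint) auto
    then show "card (h ` ?J \<union> d ` ?K) = card {1..L i}" using i by (simp add: L_def)
  qed simp
  then have "(\<Prod>k = 1..L i. G k) = prod G (h ` ?J) * prod G (d ` ?K)"
    using disj by (subst prod.union_disjoint[symmetric]) auto
  then show ?thesis
    by (simp only: prod.reindex[OF h_inj] prod.reindex[OF d_inj] o_def h_def[symmetric] d_def[symmetric])
qed

lemma prod_boxes:
  assumes "l \<in> partitions" "length l \<le> n"
  shows "(\<Prod>v\<in>boxes l. f v) = (\<Prod>i<n. \<Prod>j = 1..pad l i. f (Suc i, j))"
proof -
  have "(\<Prod>v\<in>boxes l. f v) = (\<Prod>i = 1..length l. \<Prod>j = 1..part l i. f (i, j))"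
    unfolding boxes_def by (subst prod.Sigma) auto
  also have "\<dots> = (\<Prod>i<length l. \<Prod>j = 1..pad l i. f (Suc i, j))"
    by (rule prod.reindex_bij_witness[of _ "\<lambda>i. i + 1" "\<lambda>i. i - 1"]) (auto simp: part_def pad_def)
  also have "\<dots> = (\<Prod>i<n. \<Prod>j = 1..pad l i. f (Suc i, j))"
    using assms(2) by (intro prod.mono_neutral_left) (auto simp: pad_def)
  finally show ?thesis .
qed

text \<open>\<open>G\<close> is kept general because it is later \<open>of_nat\<close>,
  \<open>1 - x^k\<close> and \<open>1 - m^2 / k^2\<close>; the multiplicative form allows values of
  \<open>G\<close> that are zero.\<close>

theorem hook_product:
  fixes G :: "nat \<Rightarrow> 'a::comm_monoid_mult"
  assumes l: "l \<in> partitions" "length l \<le> n"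
  defines "L \<equiv> beta_seq n l"
  shows "(\<Prod>v\<in>boxes l. G (hook_length l v)) * (\<Prod>j<n. \<Prod>i<j. G (L i - L j)) = (\<Prod>i<n. \<Prod>k = 1..L i. G k)"
proof -
  have "(\<Prod>j<n. \<Prod>i<j. G (L i - L j)) = (\<Prod>i<n. \<Prod>k\<in>{i<..<n}. G (L i - L k))"
    unfolding prod.Sigma[of "{..<n}", simplified]
    by (subst (1 2) prod.Sigma; simp?)
       (rule prod.reindex_bij_witness[of _ "\<lambda>(i, j). (j, i)" "\<lambda>(i, j). (j, i)"]; auto)
  then show ?thesis
    unfolding L_def prod_boxes[OF l]
    by (simp only: prod.distrib[symmetric]) (intro prod.cong refl, simp only: hook_row[OF l] lessThan_iff)
qed

text \<open>In row \<open>i\<close>, counted from 0, the factors are the consecutive numbers from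
  \<open>n - i\<close> to \<open>beta_seq n l i\<close>, a quotient of factorials.\<close>

lemma content_product:
  assumes l: "l \<in> partitions" "length l \<le> n"
  shows "(\<Prod>v\<in>boxes l. of_int (box_content v) + of_nat n) * (\<Prod>k<n. fact k)
    = (\<Prod>i<n. fact (beta_seq n l i) :: 'a::field_char_0)"
proof -
  have row: "(\<Prod>j = 1..p. of_int (box_content (Suc i, j)) + of_nat n) * fact (n - 1 - i)
      = (fact (p + (n - 1 - i)) :: 'a)" if "i < n" for i p
  proof (induction p)
    case (Suc p)
    have "of_int (box_content (Suc i, Suc p)) + of_nat n = (of_nat (Suc p + (n - 1 - i)) :: 'a)"
      using that by (simp add: box_content_def of_nat_diff)
    then show ?case using Suc by (simp add: mult_ac)
  qed simp
  have "(\<Prod>k<n. fact k :: 'a) = (\<Prod>i<n. fact (n - 1 - i))"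
    by (rule prod.reindex_bij_witness[of _ "\<lambda>i. n - 1 - i" "\<lambda>i. n - 1 - i"]) auto
  then show ?thesis
    unfolding prod_boxes[OF l] using row by (simp add: prod.distrib[symmetric])
qed

lemma content_product_zero:
  assumes "l \<in> partitions" "n < length l"
  shows "(\<Prod>v\<in>boxes l. of_int (box_content v) + of_nat n :: 'a::field_char_0) = 0"
proof (rule prod_zero)
  have "(Suc n, 1) \<in> boxes l"
    using assms by (auto simp: boxes_def part_def partitions_def Suc_le_eq)
  then show "\<exists>v\<in>boxes l. of_int (box_content v) + of_nat n = (0 :: 'a)"
    by (intro bexI[of _ "(Suc n, 1)"]) (simp_all add: box_content_def)
qed (simp add: boxes_def)

section \<open>The diagonal hook sum\<close>

text \<open>A skew Schur function vanishes unless the shapes are nested. The entries in rows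
  \<open>\<ge> i\<close> and columns \<open>\<le> i\<close> are all zero, and by the pigeonhole
  principle every permutation meets this block.\<close>

lemma fdet_support:
  assumes L: "L \<in> sdec n A" and M: "M \<in> sdec n B"
    and f: "\<And>i j. i < n \<Longrightarrow> j < n \<Longrightarrow> L i < M j \<Longrightarrow> f i j = 0"
    and i: "i < n" "L i < M i"
  shows "fdet n f = 0"
  unfolding fdet_perm
proof (rule sum.neutral, safe)
  fix p assume p: "p permutes {..<n}"
  have "\<exists>k\<in>{i..<n}. p k \<le> i"
  proof (rule ccontr)
    assume "\<not> ?thesis"
    then have "p ` {i..<n} \<subseteq> {Suc i..<n}"
      using permutes_in_image[OF p] by (auto simp: not_le Suc_le_eq)
    then have "card (p ` {i..<n}) \<le> card {Suc i..<n}" by (intro card_mono) auto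
    moreover have "card (p ` {i..<n}) = card {i..<n}"
      by (rule card_image) (rule permutes_inj_on[OF p])
    ultimately show False using i by simp
  qed
  then obtain k where k: "i \<le> k" "k < n" "p k \<le> i" by auto
  have "L k < M (p k)"
    using sdec_le[OF L k(1,2)] sdec_le[OF M k(3) i(1)] i(2) by simp
  then have "f k (p k) = 0" using f k permutes_in_image[OF p, of k] by auto
  then have "(\<Prod>i<n. f i (p i)) = 0" using k by (intro prod_zero) auto
  then show "signof p * (\<Prod>i<n. f i (p i)) = 0" by simp
qed

lemma isCont_hh [continuous_intros]: "isCont (\<lambda>m. hh m L M) z"
  by (cases "M \<le> L") (auto simp: hh_def gbinomial_prod_rev intro!: continuous_intros)

lemma isCont_ee [continuous_intros]: "isCont (\<lambda>m. ee m L M) z"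
  by (cases "M \<le> L") (auto simp: ee_def gbinomial_prod_rev intro!: continuous_intros)

lemma non_integer_approximation:
  "\<exists>s :: nat \<Rightarrow> complex. (\<forall>k. s k \<notin> \<int>) \<and> s \<longlonglongrightarrow> of_nat m"
proof (intro exI conjI allI)
  let ?s = "\<lambda>k. of_nat m + of_real (1 / real (k + 2)) :: complex"
  show "?s k \<notin> \<int>" for k
  proof
    assume "?s k \<in> \<int>"
    then have "?s k - of_nat m \<in> \<int>" by (intro Ints_diff) auto
    then have "(of_real (1 / real (k + 2)) :: complex) \<in> \<int>" by simp
    then obtain z where "of_real (1 / real (k + 2)) = (of_int z :: complex)"
      by (auto elim: Ints_cases)
    then have "1 / real (k + 2) = of_int z"
      by (metis of_real_eq_iff of_real_of_int_eq)
    moreover have "0 < 1 / real (k + 2)" "1 / real (k + 2) < 1" by auto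
    ultimately have "0 < real_of_int z" "real_of_int z < 1" by metis+
    then have "0 < z" "z < 1" by simp_all
    then show False by simp
  qed
  have "(\<lambda>k. of_nat m + complex_of_real (1 / real (k + 2))) \<longlonglongrightarrow> of_nat m + of_real 0"
    using LIMSEQ_ignore_initial_segment[OF lim_inverse_n', of 2] by (intro tendsto_intros)
  then show "?s \<longlonglongrightarrow> of_nat m" by simp
qed

text \<open>For an integer \<open>m\<close> the Cauchy determinant degenerates to \<open>0 / 0\<close>, hence the passage to the limit from
  non-integers.\<close>

theorem diagonal_hook_sum:
  assumes l: "l \<in> partitions" "length l \<le> n" and L: "beta_seq n l \<in> sdec n {..B}"
  shows "(\<Sum>M\<in>sdec n {..B}. fdet n (\<lambda>i j. hh (of_nat m) (beta_seq n l i) (M j)) *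
      fdet n (\<lambda>i j. ee (of_nat m) (beta_seq n l i) (M j)))
    = (\<Prod>v\<in>boxes l. 1 - (of_nat m)\<^sup>2 / (of_nat (hook_length l v))\<^sup>2)"
proof -
  define S where "S z = fdet n (\<lambda>i j. \<Sum>k\<le>B. hh z (beta_seq n l i) k
      * ee z (beta_seq n l j) k)" for z
  define H where "H z = (\<Prod>v\<in>boxes l. 1 - z\<^sup>2 / (of_nat (hook_length l v))\<^sup>2)" for z :: complex
  have SH: "S z = H z" if z: "z \<notin> \<int>" for z
  proof -
    define D where "D = (\<Prod>j<n. \<Prod>i<j. 1 - z\<^sup>2 / (of_nat (beta_seq n l i - beta_seq n l j))\<^sup>2)"
    have nz: "1 - z\<^sup>2 / (of_nat k)\<^sup>2 \<noteq> 0" for k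
    proof
      assume *: "1 - z\<^sup>2 / (of_nat k)\<^sup>2 = 0"
      then have "k \<noteq> 0" by auto
      then have "z\<^sup>2 = (of_nat k)\<^sup>2" using * by (simp add: field_simps)
      then have "z = of_nat k \<or> z = - of_nat k" by (simp add: power2_eq_iff)
      then show False using z by auto
    qed
    have "D \<noteq> 0" unfolding D_def prod_zero_iff[OF finite_lessThan] using nz by blast
    moreover have "S z * D = H z * D"
      unfolding S_def D_def H_def using cauchy_det_kernel[OF L z]
        hook_product[OF l, of "\<lambda>k. 1 - z\<^sup>2 / (of_nat k)\<^sup>2"] by simp
    ultimately show ?thesis by simp
  qed
  obtain s :: "nat \<Rightarrow> complex" where s: "\<And>k. s k \<notin> \<int>" "s \<longlonglongrightarrow> of_nat m"
    using non_integer_approximation by blast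
  have "isCont S (of_nat m)" unfolding S_def fdet_perm by (intro continuous_intros)
  then have "(\<lambda>k. S (s k)) \<longlonglongrightarrow> S (of_nat m)" using s(2) by (rule isCont_tendsto_compose)
  moreover have "isCont H (of_nat m)" unfolding H_def divide_inverse by (intro continuous_intros)
  then have "(\<lambda>k. H (s k)) \<longlonglongrightarrow> H (of_nat m)" using s(2) by (rule isCont_tendsto_compose)
  ultimately have "S (of_nat m) = H (of_nat m)" using SH s(1) by (simp add: LIMSEQ_unique)
  moreover have "S z = (\<Sum>M\<in>sdec n {..B}. fdet n (\<lambda>i j. hh z (beta_seq n l i) (M j)) *
      fdet n (\<lambda>i j. ee z (beta_seq n l i) (M j)))" for z
    unfolding S_def
    by (subst cauchy_binet[symmetric]) (simp_all add: fdet_transpose[of n "\<lambda>i j. ee z (beta_seq n l i) (_ j)"])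
  ultimately show ?thesis by (simp add: H_def)
qed

section \<open>Horizontal and vertical strips\<close>

text \<open>\<open>interlacing n L M\<close> means that the two encoded shapes differ by a horizontal strip.\<close>

definition interlacing :: "nat \<Rightarrow> (nat \<Rightarrow> nat) \<Rightarrow> (nat \<Rightarrow> nat) \<Rightarrow> bool" where
  "interlacing n L M \<longleftrightarrow> (\<forall>i<n. M i \<le> L i) \<and> (\<forall>i. Suc i < n \<longrightarrow> L (Suc i) < M i)"

text \<open>The entries are 0 or 1. Interlacing makes the matrix unitriangular; otherwise two
  neighbouring rows coincide, or the shapes are not nested.\<close>

lemma fdet_hh_one:
  assumes L: "L \<in> sdec n A" and M: "M \<in> sdec n B"
  shows "fdet n (\<lambda>i j. hh 1 (L i) (M j)) = (if interlacing n L M then 1 else 0)"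
proof (cases "interlacing n L M")
  case True
  have "fdet n (\<lambda>i j. hh 1 (L i) (M j)) = (\<Prod>i<n. hh 1 (L i) (M i))"
  proof (rule fdet_upper_triangular)
    fix i j assume ij: "j < i" "i < n"
    then obtain k where k: "i = Suc k" by (cases i) auto
    have "L i < M k" using True ij k by (auto simp: interlacing_def)
    also have "M k \<le> M j" using ij k by (intro sdec_le[OF M]) auto
    finally show "hh 1 (L i) (M j) = 0" by (simp add: hh_one)
  qed
  then show ?thesis using True by (simp add: interlacing_def hh_one)
next
  case False
  have "fdet n (\<lambda>i j. hh 1 (L i) (M j)) = 0"
  proof (cases "\<forall>i<n. M i \<le> L i")
    case below: True
    with False have ex: "\<exists>i. Suc i < n \<and> M i \<le> L (Suc i)" by (auto simp: interlacing_def not_less)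
    \<comment> \<open>Minimality makes the columns before \<open>i\<close> vanish in row
      \<open>i\<close>, so that this row agrees with the next one everywhere.\<close>
    define i where "i = (LEAST i. Suc i < n \<and> M i \<le> L (Suc i))"
    have i: "Suc i < n" "M i \<le> L (Suc i)" using LeastI_ex[OF ex] by (auto simp: i_def)
    have least: "L (Suc k) < M k" if "k < i" for k
      using not_less_Least[of k "\<lambda>i. Suc i < n \<and> M i \<le> L (Suc i)"] that i(1)
        by (auto simp: i_def[symmetric])
    have "M j \<le> L i \<longleftrightarrow> M j \<le> L (Suc i)" if j: "j < n" for j
    proof
      assume le: "M j \<le> L i"
      have "i \<le> j"
      proof (rule ccontr)
        assume "\<not> i \<le> j"
        then obtain k where k: "i = Suc k" "j \<le> k" by (cases i) auto
        have "L i < M k" using least[of k] k by simp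
        also have "M k \<le> M j" using k i by (intro sdec_le[OF M]) auto
        finally show False using le by simp
      qed
      then show "M j \<le> L (Suc i)" using sdec_le[OF M _ j, of i] i(2) by simp
    next
      assume "M j \<le> L (Suc i)"
      then show "M j \<le> L i" using sdec_less[OF L, of i "Suc i"] i(1) by simp
    qed
    then show ?thesis
      using i(1) by (intro fdet_identical_rows[of i n "Suc i"]) (auto simp: hh_one)
  next
    case False
    then obtain i where "i < n" "L i < M i" by (auto simp: not_le)
    then show ?thesis by (intro fdet_support[OF L M]) (auto simp: hh_def)
  qed
  then show ?thesis using False by simp
qed

lemma permutes_mono_id:
  assumes p: "p permutes {..<n::nat}" and mono: "\<And>i j. i < j \<Longrightarrow> j < n \<Longrightarrow> p i \<le> p j"
  shows "p = id"
proof (rule ccontr)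
  assume "p \<noteq> id"
  then obtain i where i: "p i \<noteq> i" by (auto simp: fun_eq_iff)
  have less: "p i < p j" if "i < j" "j < n" for i j
    using mono[OF that] permutes_inj[OF p] that by (metis inj_eq nat_less_le order_less_irrefl)
  have ge: "i \<le> p i" if "i < n" for i
    using that
  proof (induction i)
    case (Suc i)
    then show ?case using less[of i "Suc i"] by simp
  qed simp
  have "i < n" using i permutes_not_in[OF p, of i] by auto
  have "(\<Sum>i<n. i) < (\<Sum>i<n. p i)"
    using ge i \<open>i < n\<close> by (intro sum_strict_mono_ex1) (auto intro!: bexI[of _ i] simp: less_le)
  moreover have "(\<Sum>i<n. p i) = (\<Sum>i<n. i)"
    using sum.permute[OF p, of "\<lambda>i. i"] by (simp add: o_def)
  ultimately show False by simp
qed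

text \<open>A nonzero term needs \<open>M (p i)\<close> to be \<open>L i\<close> or
  \<open>L i - 1\<close> in every row. As \<open>L\<close> drops by at least 1 from row to row,
  \<open>p\<close> must be monotone, hence the identity.\<close>

lemma fdet_ee_one:
  assumes L: "L \<in> sdec n A" and M: "M \<in> sdec n B"
  shows "fdet n (\<lambda>i j. ee 1 (L i) (M j)) = (\<Prod>i<n. ee 1 (L i) (M i))"
proof -
  have "(\<Prod>i<n. ee 1 (L i) (M (p i))) = 0" if p: "p permutes {..<n}" "p \<noteq> id" for p
  proof (rule ccontr)
    assume "(\<Prod>i<n. ee 1 (L i) (M (p i))) \<noteq> 0"
    then have nz: "L i = M (p i) \<or> L i = Suc (M (p i))" if "i < n" for i
      using that by (force simp: prod_zero_iff ee_one split: if_splits)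
    have "p i \<le> p j" if "i < j" "j < n" for i j
    proof (rule ccontr)
      assume "\<not> p i \<le> p j"
      then have "M (p i) < M (p j)"
        using sdec_less[OF M, of "p j" "p i"] permutes_in_image[OF p(1), of i] that by simp
      then show False using nz[of i] nz[of j] sdec_less[OF L that] that by auto
    qed
    then show False using permutes_mono_id[OF p(1)] p(2) by blast
  qed
  then have "fdet n (\<lambda>i j. ee 1 (L i) (M j)) = (\<Sum>p\<in>{id}. signof p * (\<Prod>i<n. ee 1 (L i) (M (p i))))"
    unfolding fdet_perm
      by (intro sum.mono_neutral_right) (auto simp: permutes_id finite_permutations)
  then show ?thesis by simp
qed

text \<open>The commutation rule for adding a horizontal and removing a vertical strip. Row by row, the
  weights on the two sides differ only by the state \<open>strip_state\<close> of the preceding row, so the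
  identity telescopes.\<close>

definition strip_state :: "'a::comm_ring_1 \<Rightarrow> nat \<Rightarrow> nat \<Rightarrow> 'a" where
  "strip_state a p q = (if p \<le> q then a ^ (q - p) * (1 - a) else if p = Suc q then - 1 else 0)"

text \<open>Row \<open>i + 1\<close> of the larger shape is summed out: \<open>p\<close>,
  \<open>p'\<close> are rows \<open>i\<close> and \<open>i + 1\<close> of \<open>M\<close>, and
  \<open>q'\<close> is row \<open>i + 1\<close> of \<open>N\<close>. The row can be
  \<open>q'\<close> or, with sign \<open>- 1\<close>, \<open>q' + 1\<close>.\<close>

definition up_weight :: "'a::comm_ring_1 \<Rightarrow> nat \<Rightarrow> nat \<Rightarrow> nat \<Rightarrow> 'a" where
  "up_weight a p p' q' = (if p' \<le> q' \<and> q' < p then a ^ (q' - p') else 0)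
     - (if p' \<le> Suc q' \<and> Suc q' < p then a ^ (Suc q' - p') else 0)"

text \<open>Row \<open>i\<close> of the smaller shape is summed out: \<open>p\<close> is row
  \<open>i\<close> of \<open>M\<close>, and \<open>q\<close>, \<open>q'\<close> are rows
  \<open>i\<close> and \<open>i + 1\<close> of \<open>N\<close>. The row can be \<open>p\<close> or,
  with sign \<open>- 1\<close>, \<open>p - 1\<close>.\<close>

definition down_weight :: "'a::comm_ring_1 \<Rightarrow> nat \<Rightarrow> nat \<Rightarrow> nat \<Rightarrow> 'a" where
  "down_weight a p q q' = (if p \<le> q \<and> q' < p then a ^ (q - p) else 0)
     - (if p \<le> Suc q \<and> Suc q' < p then a ^ (Suc q - p) else 0)"

text \<open>The local exchange rule: the state moves one row down while an up weight turns into a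
  down weight.\<close>

lemma strip_state_step:
  assumes "p' < p" "q' < q"
  shows "strip_state a p q * up_weight a p p' q' = down_weight a p q q' * strip_state a p' q'"
proof -
  consider "p \<le> q" | "p = Suc q" | "Suc q < p" by linarith
  then show ?thesis
  proof cases
    case 1
    consider "p' \<le> q'" | "p' = Suc q'" | "Suc q' < p'" by linarith
    then show ?thesis
      using 1 assms
      by cases (auto simp: strip_state_def up_weight_def down_weight_def Suc_diff_le algebra_simps)
  next
    case 2
    consider "p' \<le> q'" | "p' = Suc q'" | "Suc q' < p'" by linarith
    then show ?thesis
      using 2 assms
      by cases (auto simp: strip_state_def up_weight_def down_weight_def Suc_diff_le algebra_simps)
  next
    case 3
    then show ?thesis by (simp add: strip_state_def down_weight_def)
  qed
qed

definition skew_size :: "nat \<Rightarrow> (nat \<Rightarrow> nat) \<Rightarrow> (nat \<Rightarrow> nat) \<Rightarrow> nat" where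
  "skew_size n L M = (\<Sum>i<n. L i - M i)"

text \<open>The entries of \<open>ee 1\<close> in an arbitrary ring; the commutation rule is later
  applied to power series, with \<open>a\<close> a power of \<open>x\<close>.\<close>

definition vstrip :: "nat \<Rightarrow> nat \<Rightarrow> 'a::comm_ring_1" where
  "vstrip x y = (if x = y then 1 else if x = Suc y then - 1 else 0)"

text \<open>When nonzero weights already force strict decrease, the sum extends to all maps and
  factors into row sums.\<close>

lemma sum_over_strip:
  fixes W :: "nat \<Rightarrow> nat \<Rightarrow> 'a::comm_ring_1"
  assumes "\<And>L. L \<in> {..<n} \<rightarrow>\<^sub>E {..K} \<Longrightarrow> (\<And>i. i < n \<Longrightarrow> W i (L i) \<noteq> 0) \<Longrightarrow> L \<in> sdec n {..K}"
  shows "(\<Sum>L\<in>sdec n {..K}. \<Prod>i<n. W i (L i)) = (\<Prod>i<n. \<Sum>t\<le>K. W i t)"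
proof -
  have "(\<Sum>L\<in>sdec n {..K}. \<Prod>i<n. W i (L i)) = (\<Sum>L\<in>{..<n} \<rightarrow>\<^sub>E {..K}. \<Prod>i<n. W i (L i))"
  proof (rule sum.mono_neutral_left)
    show "\<forall>L\<in>({..<n} \<rightarrow>\<^sub>E {..K}) - sdec n {..K}. (\<Prod>i<n. W i (L i)) = 0"
    proof
      fix L assume "L \<in> ({..<n} \<rightarrow>\<^sub>E {..K}) - sdec n {..K}"
      then obtain i where "i < n" "W i (L i) = 0" using assms by blast
      then show "(\<Prod>i<n. W i (L i)) = 0" by (intro prod_zero) auto
    qed
  qed (auto simp: sdec_def intro: finite_PiE)
  then show ?thesis by (simp add: prod_sum_PiE)
qed

lemma sum_vstrip:
  fixes f :: "nat \<Rightarrow> 'a::comm_ring_1"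
  assumes "Suc q \<le> K"
  shows "(\<Sum>t\<le>K. f t * vstrip t q) = f q - f (Suc q)"
proof -
  have "(\<Sum>t\<le>K. f t * vstrip t q) = (\<Sum>t\<in>{q, Suc q}. f t * vstrip t q)"
    using assms by (intro sum.mono_neutral_right) (auto simp: vstrip_def)
  then show ?thesis by (simp add: vstrip_def)
qed

lemma sum_vstrip':
  fixes f :: "nat \<Rightarrow> 'a::comm_ring_1"
  assumes "p \<le> K"
  shows "(\<Sum>t\<le>K. f t * vstrip p t) = f p - (if p = 0 then 0 else f (p - 1))"
proof -
  have "(\<Sum>t\<le>K. f t * vstrip p t) = (\<Sum>t\<in>{p} \<union> (if p = 0 then {} else {p - 1}). f t * vstrip p t)"
    using assms by (intro sum.mono_neutral_right) (auto simp: vstrip_def split: if_splits)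
  then show ?thesis by (cases p) (auto simp: vstrip_def)
qed

text \<open>The top row has no upper neighbour to bound it, so its row sum is
  \<open>strip_state\<close> instead of \<open>up_weight\<close>. The bound \<open>K\<close> leaves
  room for rows \<open>N i + 1\<close>.\<close>

lemma sum_up:
  assumes M: "M \<in> sdec n {..B}" and N: "N \<in> sdec n {..B}" and K: "Suc B \<le> K" and n: "0 < n"
  shows "(\<Sum>L\<in>sdec n {..K}. if interlacing n L M then a ^ skew_size n L M
      * (\<Prod>i<n. vstrip (L i) (N i)) else 0)
    = strip_state a (M 0) (N 0) * (\<Prod>i<n - 1. up_weight a (M i) (M (Suc i)) (N (Suc i)))"
proof -
  define u where "u i t \<longleftrightarrow> M i \<le> t \<and> (0 < i \<longrightarrow> t < M (i - 1))" for i t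
  define W where "W i t = (if u i t then a ^ (t - M i) else 0) * vstrip t (N i)" for i t
  have interlacing: "interlacing n L M \<longleftrightarrow> (\<forall>i<n. u i (L i))" for L
  proof -
    have "(\<forall>i. Suc i < n \<longrightarrow> L (Suc i) < M i) \<longleftrightarrow> (\<forall>i<n. 0 < i \<longrightarrow> L i < M (i - 1))"
      by (metis Suc_pred diff_Suc_1 zero_less_Suc)
    then show ?thesis by (auto simp: interlacing_def u_def)
  qed
  have "(\<Sum>L\<in>sdec n {..K}. if interlacing n L M then a ^ skew_size n L M
      * (\<Prod>i<n. vstrip (L i) (N i)) else 0)
      = (\<Sum>L\<in>sdec n {..K}. \<Prod>i<n. W i (L i))"
  proof (rule sum.cong[OF refl])
    fix L
    show "(if interlacing n L M then a ^ skew_size n L M * (\<Prod>i<n. vstrip (L i) (N i)) else 0)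
        = (\<Prod>i<n. W i (L i))"
    proof (cases "interlacing n L M")
      case True
      then show ?thesis
        by (simp add: interlacing W_def prod.distrib skew_size_def power_sum)
    next
      case False
      then obtain i where "i < n" "\<not> u i (L i)" by (auto simp: interlacing)
      then have "(\<Prod>i<n. W i (L i)) = 0" by (intro prod_zero) (auto simp: W_def)
      then show ?thesis using False by simp
    qed
  qed
  also have "\<dots> = (\<Prod>i<n. \<Sum>t\<le>K. W i t)"
  proof (rule sum_over_strip)
    fix L assume L: "L \<in> {..<n} \<rightarrow>\<^sub>E {..K}" and nz: "\<And>i. i < n \<Longrightarrow> W i (L i) \<noteq> 0"
    have u: "u i (L i)" if "i < n" for i using nz[OF that] by (auto simp: W_def split: if_splits)
    have "L j < L i" if "i < j" "j < n" for i j
    proof -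
      have "L j < M (j - 1)" using u[of j] that by (simp add: u_def)
      also have "M (j - 1) \<le> M i" using that by (intro sdec_le[OF M]) auto
      also have "M i \<le> L i" using u[of i] that by (simp add: u_def)
      finally show ?thesis .
    qed
    then show "L \<in> sdec n {..K}" using L by (simp add: sdec_def)
  qed
  also have "\<dots> = (\<Prod>i<n. (if u i (N i) then a ^ (N i - M i) else 0)
      - (if u i (Suc (N i)) then a ^ (Suc (N i) - M i) else 0))"
    unfolding W_def using sdec_mem[OF N] K
    by (intro prod.cong refl sum_vstrip) (metis Suc_le_mono atMost_iff lessThan_iff order.trans)
  also have "\<dots> = strip_state a (M 0) (N 0) * (\<Prod>i<n - 1. up_weight a (M i) (M (Suc i)) (N (Suc i)))"
  proof -
    obtain k where k: "n = Suc k" using n by (cases n) auto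
    show ?thesis unfolding k prod.lessThan_Suc_shift
      by (auto simp: u_def up_weight_def strip_state_def Suc_diff_le algebra_simps)
  qed
  finally show ?thesis .
qed

lemma sum_down:
  assumes M: "M \<in> sdec n {..K}" and N: "N \<in> sdec n {..K}" and n: "0 < n"
    and last: "M (n - 1) = 0" "N (n - 1) = 0"
  shows "(\<Sum>T\<in>sdec n {..K}. if interlacing n N T then a ^ skew_size n N T
      * (\<Prod>i<n. vstrip (M i) (T i)) else 0)
    = (\<Prod>i<n - 1. down_weight a (M i) (N i) (N (Suc i)))"
proof -
  define u where "u i t \<longleftrightarrow> t \<le> N i \<and> (Suc i < n \<longrightarrow> N (Suc i) < t)" for i t
  define W where "W i t = (if u i t then a ^ (N i - t) else 0) * vstrip (M i) t" for i t
  have interlacing: "interlacing n N T \<longleftrightarrow> (\<forall>i<n. u i (T i))" for T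
    by (auto simp: interlacing_def u_def)
  have "(\<Sum>T\<in>sdec n {..K}. if interlacing n N T then a ^ skew_size n N T
      * (\<Prod>i<n. vstrip (M i) (T i)) else 0)
      = (\<Sum>T\<in>sdec n {..K}. \<Prod>i<n. W i (T i))"
  proof (rule sum.cong[OF refl])
    fix T
    show "(if interlacing n N T then a ^ skew_size n N T * (\<Prod>i<n. vstrip (M i) (T i)) else 0)
        = (\<Prod>i<n. W i (T i))"
    proof (cases "interlacing n N T")
      case True
      then show ?thesis
        by (simp add: interlacing W_def prod.distrib skew_size_def power_sum)
    next
      case False
      then obtain i where "i < n" "\<not> u i (T i)" by (auto simp: interlacing)
      then have "(\<Prod>i<n. W i (T i)) = 0" by (intro prod_zero) (auto simp: W_def)
      then show ?thesis using False by simp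
    qed
  qed
  also have "\<dots> = (\<Prod>i<n. \<Sum>t\<le>K. W i t)"
  proof (rule sum_over_strip)
    fix T assume T: "T \<in> {..<n} \<rightarrow>\<^sub>E {..K}" and nz: "\<And>i. i < n \<Longrightarrow> W i (T i) \<noteq> 0"
    have u: "u i (T i)" if "i < n" for i using nz[OF that] by (auto simp: W_def split: if_splits)
    have "T j < T i" if "i < j" "j < n" for i j
    proof -
      have "T j \<le> N j" using u[of j] that by (simp add: u_def)
      also have "N j \<le> N (Suc i)" using that by (intro sdec_le[OF N]) auto
      also have "N (Suc i) < T i" using u[of i] that by (simp add: u_def)
      finally show ?thesis .
    qed
    then show "T \<in> sdec n {..K}" using T by (simp add: sdec_def)
  qed
  also have "\<dots> = (\<Prod>i<n. (if u i (M i) then a ^ (N i - M i) else 0)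
      - (if M i = 0 then 0 else if u i (M i - 1) then a ^ (N i - (M i - 1)) else 0))"
    unfolding W_def using sdec_mem[OF M] by (intro prod.cong refl sum_vstrip') auto
  also have "\<dots> = (\<Prod>i<n - 1. down_weight a (M i) (N i) (N (Suc i)))"
  proof -
    obtain k where k: "n = Suc k" using n by (cases n) auto
    have "(\<Prod>i<k. (if u i (M i) then a ^ (N i - M i) else 0)
      - (if M i = 0 then 0 else if u i (M i - 1) then a ^ (N i - (M i - 1)) else 0))
      = (\<Prod>i<k. down_weight a (M i) (N i) (N (Suc i)))"
    proof (rule prod.cong[OF refl])
      fix i assume "i \<in> {..<k}"
      then have u: "u i t \<longleftrightarrow> t \<le> N i \<and> N (Suc i) < t" for t by (simp add: u_def k)
      have "M i > 0" using sdec_less[OF M, of i "n - 1"] \<open>i \<in> {..<k}\<close> k by auto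
      then show "(if u i (M i) then a ^ (N i - M i) else 0)
          - (if M i = 0 then 0 else if u i (M i - 1) then a ^ (N i - (M i - 1)) else 0)
        = down_weight a (M i) (N i) (N (Suc i))"
        by (cases "M i") (auto simp: u down_weight_def)
    qed
    \<comment> \<open>The last row is empty in both shapes and contributes 1, so only
      \<open>n - 1\<close> factors remain.\<close>
    moreover have "u k 0" by (simp add: u_def k)
    ultimately show ?thesis using last by (simp add: k)
  qed
  finally show ?thesis .
qed

theorem strip_commutation:
  fixes a :: "'a::comm_ring_1"
  assumes M: "M \<in> sdec n {..B}" and N: "N \<in> sdec n {..B}" and K: "Suc B \<le> K" and n: "0 < n"
    and last: "M (n - 1) = 0" "N (n - 1) = 0"
  shows "(\<Sum>L\<in>sdec n {..K}. if interlacing n L M then a ^ skew_size n L M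
      * (\<Prod>i<n. vstrip (L i) (N i)) else 0)
    = (1 - a) * (\<Sum>T\<in>sdec n {..B}.
      if interlacing n N T then a ^ skew_size n N T * (\<Prod>i<n. vstrip (M i) (T i)) else 0)"
proof -
  have "strip_state a (M 0) (N 0) * (\<Prod>i<k. up_weight a (M i) (M (Suc i)) (N (Suc i)))
      = (\<Prod>i<k. down_weight a (M i) (N i) (N (Suc i))) * strip_state a (M k) (N k)" if "k < n" for k
    using that
  proof (induction k)
    case (Suc k)
    have "strip_state a (M k) (N k) * up_weight a (M k) (M (Suc k)) (N (Suc k))
      = down_weight a (M k) (N k) (N (Suc k)) * strip_state a (M (Suc k)) (N (Suc k))"
      using Suc.prems sdec_less[OF M, of k "Suc k"] sdec_less[OF N, of k "Suc k"]
      by (intro strip_state_step) auto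
    moreover have "strip_state a (M 0) (N 0) * (\<Prod>i<k. up_weight a (M i) (M (Suc i)) (N (Suc i)))
      = (\<Prod>i<k. down_weight a (M i) (N i) (N (Suc i))) * strip_state a (M k) (N k)"
      using Suc by simp
    ultimately show ?case by (simp add: mult.assoc[symmetric]) (simp add: mult.assoc)
  qed simp
  \<comment> \<open>Both last entries are 0, so the state that survives the telescoping is
    \<open>a ^ 0 * (1 - a)\<close>: this is the commutation factor.\<close>
  from this[of "n - 1"] show ?thesis
    unfolding sum_up[OF M N K n] sum_down[OF M N n last] using n last
    by (simp add: strip_state_def mult.commute)
qed

section \<open>Traces of strip operators\<close>

definition agree :: "nat \<Rightarrow> 'a::zero fps \<Rightarrow> 'a fps \<Rightarrow> bool" where
  "agree N f g \<longleftrightarrow> (\<forall>i\<le>N. fps_nth f i = fps_nth g i)"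

lemma agree_refl [simp]: "agree N f f"
  by (simp add: agree_def)

lemma agree_sym: "agree N f g \<Longrightarrow> agree N g f"
  by (simp add: agree_def)

lemma agree_trans [trans]: "agree N f g \<Longrightarrow> agree N g h \<Longrightarrow> agree N f h"
  by (simp add: agree_def)

lemma agree_mult: "agree N f f' \<Longrightarrow> agree N g g' \<Longrightarrow> agree N (f * g) (f' * g')"
  for f :: "'a::comm_ring_1 fps"
  by (auto simp: agree_def fps_mult_nth intro!: sum.cong)

lemma agree_add: "agree N f f' \<Longrightarrow> agree N g g' \<Longrightarrow> agree N (f + g) (f' + g')"
  for f :: "'a::comm_ring_1 fps"
  by (simp add: agree_def)

lemma agree_diff: "agree N f f' \<Longrightarrow> agree N g g' \<Longrightarrow> agree N (f - g) (f' - g')"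
  for f :: "'a::comm_ring_1 fps"
  by (simp add: agree_def)

lemma agree_sum: "(\<And>x. x \<in> A \<Longrightarrow> agree N (f x) (g x)) \<Longrightarrow> agree N (sum f A) (sum g A)"
  for f :: "'b \<Rightarrow> 'a::comm_ring_1 fps"
  by (auto simp: agree_def fps_sum_nth intro!: sum.cong)

lemma agree_prod: "(\<And>x. x \<in> A \<Longrightarrow> agree N (f x) (g x)) \<Longrightarrow> agree N (prod f A) (prod g A)"
  for f :: "'b \<Rightarrow> 'a::comm_ring_1 fps"
  by (induction A rule: infinite_finite_induct) (auto intro: agree_mult)

lemma agree_X_power: "N < k \<Longrightarrow> agree N (f * fps_X ^ k) 0"
  for f :: "'a::comm_ring_1 fps"
  by (simp add: agree_def fps_X_power_mult_right_nth)

lemma fps_const_sum: "fps_const (\<Sum>x\<in>A. f x) = (\<Sum>x\<in>A. fps_const (f x))"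
  by (induction A rule: infinite_finite_induct) (auto simp flip: fps_const_add)

lemma fps_const_prod: "fps_const (\<Prod>x\<in>A. f x) = (\<Prod>x\<in>A. fps_const (f x :: 'a::comm_ring_1))"
  by (induction A rule: infinite_finite_induct) (auto simp flip: fps_const_mult)

lemma skew_size_add:
  assumes "\<And>i. i < n \<Longrightarrow> M i \<le> T i" "\<And>i. i < n \<Longrightarrow> T i \<le> L i"
  shows "skew_size n L T + skew_size n T M = skew_size n L M"
  unfolding skew_size_def using assms by (auto simp flip: sum.distrib intro!: sum.cong)

lemma sum_skew_size:
  assumes "\<And>i. i < n \<Longrightarrow> M i \<le> L i"
  shows "(\<Sum>i<n. L i) = (\<Sum>i<n. M i) + skew_size n L M"
  unfolding skew_size_def using assms by (auto simp flip: sum.distrib intro!: sum.cong)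

section \<open>Strip operators on the shapes of size at most \<open>N\<close>\<close>

locale strips =
  fixes N :: nat
begin

abbreviation (input) rows :: nat where "rows \<equiv> Suc N"

definition base_size :: nat where "base_size = (\<Sum>i<rows. rows - 1 - i)"

text \<open>With \<open>N + 1\<close> rows every shape of size at most \<open>N\<close> has an empty last row, so that adding a strip
  cannot run out of rows.\<close>

definition shapes :: "(nat \<Rightarrow> nat) set" where
  "shapes = {L \<in> sdec rows UNIV. (\<Sum>i<rows. L i) \<le> N + base_size}"

definition shape_size :: "(nat \<Rightarrow> nat) \<Rightarrow> nat" where
  "shape_size L = (\<Sum>i<rows. L i) - base_size"

lemma base_size_le: "L \<in> sdec rows A \<Longrightarrow> base_size \<le> (\<Sum>i<rows. L i)"
  unfolding base_size_def
proof (rule sum_mono)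
  fix i assume "L \<in> sdec rows A" "i \<in> {..<rows}"
  then show "rows - 1 - i \<le> L i" using sdec_gap[of L rows A i N] by simp
qed

lemma shape_size_skew:
  assumes "L \<in> sdec rows A" "M \<in> sdec rows B" "\<And>i. i < rows \<Longrightarrow> M i \<le> L i"
  shows "shape_size L = shape_size M + skew_size rows L M"
  using sum_skew_size[of rows M L] base_size_le[OF assms(1)] base_size_le[OF assms(2)] assms(3)
  by (simp add: shape_size_def)

lemma shapes_iff: "L \<in> shapes \<longleftrightarrow> L \<in> sdec rows UNIV \<and> shape_size L \<le> N"
  using base_size_le[of L UNIV] by (auto simp: shapes_def shape_size_def)

lemma shapes_sdec: "L \<in> shapes \<Longrightarrow> L \<in> sdec rows {..N + base_size}"
proof -
  assume L: "L \<in> shapes"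
  have "L i \<le> N + base_size" if "i < rows" for i
    using member_le_sum[of i "{..<rows}" L] L that by (simp add: shapes_def)
  then show ?thesis using L by (auto simp: shapes_def sdec_def)
qed

lemma finite_shapes [simp]: "finite shapes"
  by (rule finite_subset[of _ "sdec rows {..N + base_size}"]) (auto dest: shapes_sdec)

text \<open>A positive last entry would lift all \<open>N + 1\<close> rows above the staircase and
  make the size exceed \<open>N\<close>.\<close>

lemma shapes_last: 
  assumes "L \<in> shapes"
  shows "L N = 0"
proof -
  have L: "L \<in> sdec rows UNIV" using assms by (simp add: shapes_def)
  have "(\<Sum>i<rows. L N + (rows - 1 - i)) \<le> (\<Sum>i<rows. L i)"
    using sdec_gap[OF L, of _ N] by (intro sum_mono) simp
  also have "\<dots> \<le> N + base_size" using assms by (simp add: shapes_def)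
  also have "(\<Sum>i<rows. L N + (rows - 1 - i)) = rows * L N + base_size"
    by (simp only: sum.distrib sum_constant card_lessThan base_size_def of_nat_id)
  finally have "rows * L N \<le> N" by simp
  then show ?thesis by (cases "L N") auto
qed

lemma shapes_lower:
  assumes "L \<in> shapes" "M \<in> sdec rows A" "\<And>i. i < rows \<Longrightarrow> M i \<le> L i"
  shows "M \<in> shapes"
proof -
  have "M \<in> sdec rows UNIV" using assms(2) sdec_mono[of A UNIV] by blast
  then show ?thesis using assms(1,3) shape_size_skew[of L UNIV M UNIV] by (simp add: shapes_iff)
qed

text \<open>The skew Schur function of \<open>L / M\<close> in \<open>m\<close> variables equal to
  \<open>x ^ k\<close>. The index \<open>k\<close> grows by 1 whenever the operator passes the
  grading.\<close>

definition up :: "nat \<Rightarrow> nat \<Rightarrow> (nat \<Rightarrow> nat) \<Rightarrow> (nat \<Rightarrow> nat) \<Rightarrow> complex fps" where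
  "up k m L M = fps_const (fdet rows (\<lambda>i j. hh (of_nat m) (L i) (M j))) * fps_X ^ (k
      * skew_size rows L M)"

text \<open>The arguments are swapped inside the determinant: as an operator kernel,
  \<open>down\<close> has the smaller shape first.\<close>

definition down :: "nat \<Rightarrow> (nat \<Rightarrow> nat) \<Rightarrow> (nat \<Rightarrow> nat) \<Rightarrow> complex fps" where
  "down m M L = fps_const (fdet rows (\<lambda>i j. ee (of_nat m) (L i) (M j)))"

lemma fdet_hh_nonzero:
  assumes "L \<in> sdec n A" "M \<in> sdec n B" "fdet n (\<lambda>i j. hh m (L i) (M j)) \<noteq> 0" "i < n"
  shows "M i \<le> L i"
  using assms fdet_support[OF assms(1,2), of "\<lambda>i j. hh m (L i) (M j)" i]
    by (force simp: hh_def not_le)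

lemma fdet_ee_nonzero:
  assumes "L \<in> sdec n A" "M \<in> sdec n B" "fdet n (\<lambda>i j. ee m (L i) (M j)) \<noteq> 0" "i < n"
  shows "M i \<le> L i"
  using assms fdet_support[OF assms(1,2), of "\<lambda>i j. ee m (L i) (M j)" i]
    by (force simp: ee_def not_le)

text \<open>Composition of operators truncates the intermediate shapes to size at most \<open>N\<close>. This is harmless
  for \<open>keq\<close>: the factor \<open>x ^ shape_size y\<close> pushes the lost terms beyond \<open>x ^ N\<close>.\<close>

definition kmul :: "((nat \<Rightarrow> nat) \<Rightarrow> (nat \<Rightarrow> nat) \<Rightarrow> complex fps) \<Rightarrow>
    ((nat \<Rightarrow> nat) \<Rightarrow> (nat \<Rightarrow> nat) \<Rightarrow> complex fps) \<Rightarrow> (nat \<Rightarrow> nat) \<Rightarrow> (nat \<Rightarrow> nat) \<Rightarrow> complex fps" where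
  "kmul A B x y = (\<Sum>t\<in>shapes. A x t * B t y)"

definition kscale :: "complex fps \<Rightarrow> ((nat \<Rightarrow> nat) \<Rightarrow> (nat \<Rightarrow> nat) \<Rightarrow> complex fps) \<Rightarrow>
    (nat \<Rightarrow> nat) \<Rightarrow> (nat \<Rightarrow> nat) \<Rightarrow> complex fps" where
  "kscale c A x y = c * A x y"

definition keq :: "((nat \<Rightarrow> nat) \<Rightarrow> (nat \<Rightarrow> nat) \<Rightarrow> complex fps) \<Rightarrow>
    ((nat \<Rightarrow> nat) \<Rightarrow> (nat \<Rightarrow> nat) \<Rightarrow> complex fps) \<Rightarrow> bool" where
  "keq A B \<longleftrightarrow> (\<forall>x\<in>shapes. \<forall>y\<in>shapes. agree N (A x y * fps_X ^ shape_size y) (B x y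
      * fps_X ^ shape_size y))"

text \<open>Passing the grading without division. This is what allows \<open>keq\<close>, which
  weights only the right index, to be multiplied from the right.\<close>

definition graded :: "((nat \<Rightarrow> nat) \<Rightarrow> (nat \<Rightarrow> nat) \<Rightarrow> complex fps) \<Rightarrow> bool" where
  "graded E \<longleftrightarrow> (\<exists>E'. \<forall>t\<in>shapes. \<forall>y\<in>shapes. E t y * fps_X ^ shape_size y
      = fps_X ^ shape_size t * E' t y)"

lemma kmul_assoc: "kmul (kmul A B) C = kmul A (kmul B C)"
proof (intro ext)
  fix x y
  have "kmul (kmul A B) C x y = (\<Sum>t\<in>shapes. \<Sum>s\<in>shapes. A x s * B s t * C t y)"
    by (simp add: kmul_def sum_distrib_right)
  also have "\<dots> = (\<Sum>s\<in>shapes. \<Sum>t\<in>shapes. A x s * B s t * C t y)" by (rule sum.swap)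
  also have "\<dots> = kmul A (kmul B C) x y"
    by (simp add: kmul_def sum_distrib_left mult.assoc)
  finally show "kmul (kmul A B) C x y = kmul A (kmul B C) x y" .
qed

lemma kmul_scale_left: "kmul (kscale c A) B = kscale c (kmul A B)"
  and kmul_scale_right: "kmul A (kscale c B) = kscale c (kmul A B)"
  by (simp_all add: kmul_def kscale_def fun_eq_iff sum_distrib_left mult_ac)

lemma kscale_kscale: "kscale c (kscale d A) = kscale (c * d) A"
  by (simp add: kscale_def fun_eq_iff mult.assoc)

lemma keq_trans [trans]: "keq A B \<Longrightarrow> keq B C \<Longrightarrow> keq A C"
  unfolding keq_def by (blast intro: agree_trans)

lemma keq_eqI: "(\<And>x y. x \<in> shapes \<Longrightarrow> y \<in> shapes \<Longrightarrow> A x y = B x y) \<Longrightarrow> keq A B"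
  by (simp add: keq_def)

lemma keq_scale: "keq A B \<Longrightarrow> keq (kscale c A) (kscale c B)"
  by (simp add: keq_def kscale_def mult.assoc agree_mult)

lemma keq_left: "keq A B \<Longrightarrow> keq (kmul C A) (kmul C B)"
  by (auto simp: keq_def kmul_def sum_distrib_right mult.assoc intro!: agree_sum agree_mult[OF agree_refl])

text \<open>Gradedness of \<open>E\<close> trades the weight of \<open>y\<close> for the weight of
  the intermediate shape \<open>t\<close>, to which the assumed congruence applies.\<close>

lemma keq_right:
  assumes "keq A B" "graded E"
  shows "keq (kmul A E) (kmul B E)"
proof -
  obtain E' where E': "\<And>t y. t \<in> shapes \<Longrightarrow> y \<in> shapes
      \<Longrightarrow> E t y * fps_X ^ shape_size y = fps_X ^ shape_size t * E' t y"
    using assms(2) unfolding graded_def by blast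
  have *: "kmul A E x y * fps_X ^ shape_size y = (\<Sum>t\<in>shapes. (A x t * fps_X ^ shape_size t)
      * E' t y)" if "y \<in> shapes" for A x y
    unfolding kmul_def sum_distrib_right using E'[OF _ that]
    by (intro sum.cong refl) (simp add: mult.assoc)
  show ?thesis
    unfolding keq_def
  proof (intro ballI)
    fix x y assume x: "x \<in> shapes" and y: "y \<in> shapes"
    have "agree N (A x t * fps_X ^ shape_size t) (B x t * fps_X ^ shape_size t)"
      if "t \<in> shapes" for t
      using assms(1) x that by (simp add: keq_def)
    then show "agree N (kmul A E x y * fps_X ^ shape_size y) (kmul B E x y * fps_X ^ shape_size y)"
      unfolding *[OF y]
        by (intro agree_sum agree_mult[OF _ agree_refl, of N "_ * fps_X ^ _" "_ * fps_X ^ _"])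
  qed
qed

lemma up_shift:
  assumes "x \<in> shapes" "t \<in> shapes"
  shows "up (Suc k) m x t * fps_X ^ shape_size t = fps_X ^ shape_size x * up k m x t"
proof (cases "fdet rows (\<lambda>i j. hh (of_nat m) (x i) (t j)) = 0")
  case False
  have "t i \<le> x i" if "i < rows" for i
    using fdet_hh_nonzero[OF _ _ False that] assms by (auto simp: shapes_def)
  then have "shape_size x = shape_size t + skew_size rows x t"
    using assms shape_size_skew[of x UNIV t UNIV] by (simp add: shapes_def)
  then show ?thesis by (simp add: up_def power_add[symmetric] mult_ac)
qed (simp add: up_def)

lemma graded_up: "graded (up (Suc k) m)"
  unfolding graded_def using up_shift by blast

lemma graded_down: "graded (down m)"
proof -
  have "down m t y * fps_X ^ shape_size y = fps_X ^ shape_size t * (down m t y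
      * fps_X ^ skew_size rows y t)"
    if "t \<in> shapes" "y \<in> shapes" for t y
  proof (cases "fdet rows (\<lambda>i j. ee (of_nat m) (y i) (t j)) = 0")
    case False
    have "t i \<le> y i" if "i < rows" for i
      using fdet_ee_nonzero[OF _ _ False that] \<open>t \<in> shapes\<close> \<open>y \<in> shapes\<close> by (auto simp: shapes_def)
    then have "shape_size y = shape_size t + skew_size rows y t"
      using that shape_size_skew[of y UNIV t UNIV] by (simp add: shapes_def)
    then show ?thesis by (simp add: power_add mult_ac)
  qed (simp add: down_def)
  then show ?thesis
    unfolding graded_def by (intro exI[of _ "\<lambda>t y. down m t y * fps_X ^ skew_size rows y t"] ballI)
qed

lemma sum_shapes_extend:
  assumes "\<And>t. t \<in> sdec rows {..N + base_size} \<Longrightarrow> f t \<noteq> 0 \<Longrightarrow> t \<in> shapes"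
  shows "(\<Sum>t\<in>shapes. f t) = (\<Sum>t\<in>sdec rows {..N + base_size}. f t)"
  by (rule sum.mono_neutral_left) (use assms shapes_sdec in auto)

text \<open>Cauchy--Binet turns the composition into \<open>hh_compose\<close>. It holds exactly, as
  an intermediate shape lies inside \<open>x\<close> and is not lost by the cut.
  \<open>down_compose\<close> is alike.\<close>

lemma up_compose:
  assumes "x \<in> shapes" "y \<in> shapes"
  shows "kmul (up k 1) (up k m) x y = up k (Suc m) x y"
proof -
  let ?a = "\<lambda>t. fdet rows (\<lambda>i j. hh 1 (x i) (t j))" and ?b
      = "\<lambda>t. fdet rows (\<lambda>i j. hh (of_nat m) (t i) (y j))"
  have xy: "x \<in> sdec rows UNIV" "y \<in> sdec rows UNIV" using assms by (auto simp: shapes_def)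
  have "kmul (up k 1) (up k m) x y = (\<Sum>t\<in>shapes. fps_const (?a t * ?b t) * fps_X ^ (k
      * skew_size rows x y))"
    unfolding kmul_def
  proof (rule sum.cong[OF refl])
    fix t assume t: "t \<in> shapes"
    show "up k 1 x t * up k m t y = fps_const (?a t * ?b t) * fps_X ^ (k * skew_size rows x y)"
    proof (cases "?a t = 0 \<or> ?b t = 0")
      case False
      have t': "t \<in> sdec rows UNIV" using t by (simp add: shapes_def)
      have "skew_size rows x t + skew_size rows t y = skew_size rows x y"
        using fdet_hh_nonzero[OF xy(1) t'] fdet_hh_nonzero[OF t' xy(2)] False
          by (intro skew_size_add) auto
      then have "fps_X ^ (k * skew_size rows x t) * fps_X ^ (k * skew_size rows t y)
          = (fps_X ^ (k * skew_size rows x y) :: complex fps)"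
        by (simp flip: power_add distrib_left)
      then show ?thesis by (simp add: up_def mult_ac flip: fps_const_mult)
    qed (auto simp: up_def)
  qed
  also have "\<dots> = fps_const (\<Sum>t\<in>shapes. ?a t * ?b t) * fps_X ^ (k * skew_size rows x y)"
    by (simp only: fps_const_sum sum_distrib_right)
  also have "(\<Sum>t\<in>shapes. ?a t * ?b t) = (\<Sum>t\<in>sdec rows {..N + base_size}. ?a t * ?b t)"
  proof (rule sum_shapes_extend)
    fix t assume t: "t \<in> sdec rows {..N + base_size}" and "?a t * ?b t \<noteq> 0"
    then have "?a t \<noteq> 0" by auto
    then show "t \<in> shapes"
      using fdet_hh_nonzero[OF xy(1) t] by (intro shapes_lower[OF assms(1) t]) auto
  qed
  also have "\<dots> = fdet rows (\<lambda>i j. \<Sum>l\<le>N + base_size. hh 1 (x i) l * hh (of_nat m) l (y j))"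
    by (rule cauchy_binet) simp
  also have "\<dots> = fdet rows (\<lambda>i j. hh (of_nat (Suc m)) (x i) (y j))"
    using sdec_mem[OF shapes_sdec[OF assms(1)]]
      by (intro fdet_cong) (simp add: hh_compose add.commute)
  finally show ?thesis by (simp only: up_def[of k "Suc m"])
qed

lemma down_compose:
  assumes "x \<in> shapes" "y \<in> shapes"
  shows "kmul (down m) (down 1) x y = down (Suc m) x y"
proof -
  let ?a = "\<lambda>t. fdet rows (\<lambda>i j. ee 1 (y i) (t j))" and ?b
      = "\<lambda>t. fdet rows (\<lambda>i j. ee (of_nat m) (t i) (x j))"
  have y: "y \<in> sdec rows UNIV" using assms by (auto simp: shapes_def)
  have "kmul (down m) (down 1) x y = fps_const (\<Sum>t\<in>shapes. ?a t * ?b t)"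
    by (simp add: kmul_def down_def fps_const_sum mult.commute)
  also have "(\<Sum>t\<in>shapes. ?a t * ?b t) = (\<Sum>t\<in>sdec rows {..N + base_size}. ?a t * ?b t)"
  proof (rule sum_shapes_extend)
    fix t assume t: "t \<in> sdec rows {..N + base_size}" and "?a t * ?b t \<noteq> 0"
    then have "?a t \<noteq> 0" by auto
    then show "t \<in> shapes" using fdet_ee_nonzero[OF y t] by (intro shapes_lower[OF assms(2) t]) auto
  qed
  also have "\<dots> = fdet rows (\<lambda>i j. \<Sum>l\<le>N + base_size. ee 1 (y i) l * ee (of_nat m) l (x j))"
    by (rule cauchy_binet) simp
  also have "\<dots> = fdet rows (\<lambda>i j. ee (of_nat (Suc m)) (y i) (x j))"
    using sdec_mem[OF shapes_sdec[OF assms(2)]]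
      by (intro fdet_cong) (simp add: ee_compose add.commute)
  finally show ?thesis by (simp only: down_def[of "Suc m"])
qed

lemma up_one:
  assumes "L \<in> sdec rows A" "M \<in> sdec rows B"
  shows "up k 1 L M = (if interlacing rows L M then (fps_X ^ k) ^ skew_size rows L M else 0)"
  using fdet_hh_one[OF assms] by (simp add: up_def power_mult)

lemma down_one:
  assumes "L \<in> sdec rows A" "M \<in> sdec rows B"
  shows "down 1 M L = (\<Prod>i<rows. vstrip (L i) (M i))"
proof -
  have "fps_const (ee 1 a b) = vstrip a b" for a b
    by (simp add: ee_one vstrip_def flip: fps_const_neg)
  then show ?thesis
    using fdet_ee_one[OF assms] by (simp add: down_def fps_const_prod del: prod.lessThan_Suc)
qed

text \<open>On this side the intermediate shapes contain \<open>y\<close> and may leave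
  \<open>shapes\<close>, while \<open>strip_commutation\<close> sums over all of them. The
  discrepancy is invisible modulo \<open>x ^ (N + 1)\<close>.\<close>

lemma down_up_one:
  "keq (kmul (down 1) (up (Suc k) 1)) (kscale (1 - fps_X ^ Suc k) (kmul (up (Suc k) 1) (down 1)))"
  unfolding keq_def
proof (intro ballI)
  fix x y assume x: "x \<in> shapes" and y: "y \<in> shapes"
  let ?B = "N + base_size" and ?a = "fps_X ^ Suc k :: complex fps"
  let ?F = "\<lambda>t. if interlacing rows t y then ?a ^ skew_size rows t y
      * (\<Prod>i<rows. vstrip (t i) (x i)) else 0"
  have sx: "x \<in> sdec rows {..?B}" and sy: "y \<in> sdec rows {..?B}" using shapes_sdec x y by auto
  have F: "down 1 x t * up (Suc k) 1 t y = ?F t" if "t \<in> sdec rows A" for t A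
    using up_one[OF that sy, of "Suc k"] down_one[OF that sx]   
      by (cases "interlacing rows t y") (simp_all only: if_True if_False mult_zero_left mult_zero_right mult.commute)
  have "agree N (kmul (down 1) (up (Suc k) 1) x y * fps_X ^ shape_size y) ((\<Sum>t\<in>sdec rows {..Suc ?B}. ?F t) * fps_X ^ shape_size y)"
  proof -
    let ?S = "sdec rows {..Suc ?B}"
    have fin: "finite ?S" by simp
    have sub: "shapes \<subseteq> ?S" using shapes_sdec sdec_mono[of "{..?B}" "{..Suc ?B}"] by auto
    have 1: "kmul (down 1) (up (Suc k) 1) x y = (\<Sum>t\<in>shapes. ?F t)"
      unfolding kmul_def using F[OF shapes_sdec] by (intro sum.cong) auto
    have 2: "(\<Sum>t\<in>?S. ?F t) = (\<Sum>t\<in>shapes. ?F t) + (\<Sum>t\<in>?S - shapes. ?F t)"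
      by (subst sum.subset_diff[OF sub fin]) (rule add.commute)
    have "agree N ((\<Sum>t\<in>?S - shapes. ?F t) * fps_X ^ shape_size y) (\<Sum>t\<in>?S - shapes. 0)"
      unfolding sum_distrib_right
    proof (rule agree_sum)
      fix t assume t: "t \<in> ?S - shapes"
      show "agree N (?F t * fps_X ^ shape_size y) 0"
      proof (cases "interlacing rows t y")
        case True
        have ts: "t \<in> sdec rows UNIV" using t sdec_mono[of "{..Suc ?B}" UNIV] by blast
        have "shape_size t = shape_size y + skew_size rows t y"
          using True by (intro shape_size_skew[OF ts sy]) (auto simp: interlacing_def)
        moreover have "N < shape_size t" using t ts by (auto simp: shapes_iff)
        \<comment> \<open>Each added box carries at least one \<open>x\<close>, so the total
          exponent is at least the size of \<open>t\<close>.\<close>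
        ultimately have "N < Suc k * skew_size rows t y + shape_size y" by simp
        then have "agree N ((\<Prod>i<rows. vstrip (t i) (x i)) * fps_X ^ (Suc k * skew_size rows t y
            + shape_size y)) (0 :: complex fps)"
          by (rule agree_X_power)
        moreover have "?F t * fps_X ^ shape_size y
            = (\<Prod>i<rows. vstrip (t i) (x i)) * fps_X ^ (Suc k * skew_size rows t y + shape_size y)"
          using True by (simp only: if_True power_mult[symmetric] power_add mult_ac)
        ultimately show ?thesis by simp
      qed simp
    qed
    then have "agree N ((\<Sum>t\<in>shapes. ?F t) * fps_X ^ shape_size y
        + (\<Sum>t\<in>?S - shapes. ?F t) * fps_X ^ shape_size y)
        ((\<Sum>t\<in>shapes. ?F t) * fps_X ^ shape_size y + 0)"
      unfolding sum.neutral_const by (rule agree_add[OF agree_refl])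
    then show ?thesis
      unfolding 1 2 distrib_right add_0_right by (rule agree_sym)
  qed
  moreover have "(\<Sum>t\<in>sdec rows {..Suc ?B}. ?F t)
      = (1 - ?a) * (\<Sum>t\<in>sdec rows {..?B}. if interlacing rows x t then ?a ^ skew_size rows x t *
          (\<Prod>i<rows. vstrip (y i) (t i)) else 0)"
    using strip_commutation[OF sy sx, of "Suc ?B" ?a] shapes_last[OF x] shapes_last[OF y] by simp
  moreover have "(\<Sum>t\<in>sdec rows {..?B}. if interlacing rows x t then ?a ^ skew_size rows x t *
          (\<Prod>i<rows. vstrip (y i) (t i)) else 0) = kmul (up (Suc k) 1) (down 1) x y"
  proof -
    have eq: "up (Suc k) 1 x t * down 1 t y = (if interlacing rows x t then ?a ^ skew_size rows x t *
          (\<Prod>i<rows. vstrip (y i) (t i)) else 0)" if "t \<in> sdec rows A" for t A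
      using up_one[OF sx that, of "Suc k"] down_one[OF sy that]     
        by (cases "interlacing rows x t") (simp_all only: if_True if_False mult_zero_left)
    have "kmul (up (Suc k) 1) (down 1) x y = (\<Sum>t\<in>sdec rows {..?B}. up (Suc k) 1 x t * down 1 t y)"
      unfolding kmul_def
    proof (rule sum_shapes_extend)
      fix t assume t: "t \<in> sdec rows {..?B}" and "up (Suc k) 1 x t * down 1 t y \<noteq> 0"
      then have "interlacing rows x t" unfolding eq[OF t] by (auto split: if_splits)
      then show "t \<in> shapes" by (intro shapes_lower[OF x t]) (auto simp: interlacing_def)
    qed
    then show ?thesis using eq by simp
  qed
  ultimately show "agree N (kmul (down 1) (up (Suc k) 1) x y * fps_X ^ shape_size y)
      (kscale (1 - ?a) (kmul (up (Suc k) 1) (down 1)) x y * fps_X ^ shape_size y)"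
    by (simp add: kscale_def)
qed

lemma down_up_right:
  "keq (kmul (down 1) (up (Suc k) (Suc m)))
     (kscale ((1 - fps_X ^ Suc k) ^ Suc m) (kmul (up (Suc k) (Suc m)) (down 1)))"
proof (induction m)
  case 0
  then show ?case using down_up_one by simp
next
  case (Suc m)
  let ?c = "1 - fps_X ^ Suc k :: complex fps" and ?U = "up (Suc k)" and ?D = "down 1"
  have U: "keq (?U (Suc (Suc m))) (kmul (?U 1) (?U (Suc m)))" 
    and U': "keq (kmul (?U 1) (?U (Suc m))) (?U (Suc (Suc m)))"
    by (rule keq_eqI; simp only: up_compose)+
  have "keq (kmul ?D (?U (Suc (Suc m)))) (kmul ?D (kmul (?U 1) (?U (Suc m))))"
    by (rule keq_left[OF U])
  also have "kmul ?D (kmul (?U 1) (?U (Suc m))) = kmul (kmul ?D (?U 1)) (?U (Suc m))"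
    by (simp only: kmul_assoc)
  also have "keq \<dots> (kmul (kscale ?c (kmul (?U 1) ?D)) (?U (Suc m)))"
    by (rule keq_right[OF down_up_one graded_up])
  also have "kmul (kscale ?c (kmul (?U 1) ?D)) (?U (Suc m))
      = kscale ?c (kmul (?U 1) (kmul ?D (?U (Suc m))))"
    by (simp only: kmul_scale_left kmul_assoc)
  also have "keq \<dots> (kscale ?c (kmul (?U 1) (kscale (?c ^ Suc m) (kmul (?U (Suc m)) ?D))))"
    by (intro keq_scale keq_left Suc)
  also have "\<dots> = kscale (?c ^ Suc (Suc m)) (kmul (kmul (?U 1) (?U (Suc m))) ?D)"
    by (simp only: kmul_scale_right kscale_kscale kmul_assoc power_Suc)
  also have "keq \<dots> (kscale (?c ^ Suc (Suc m)) (kmul (?U (Suc (Suc m))) ?D))"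
    by (intro keq_scale keq_right U' graded_down)
  finally show ?case .
qed

text \<open>Each of the \<open>Suc j\<close> vertical strips passes each of the \<open>Suc m\<close>
  horizontal ones, at the price of one factor \<open>1 - x ^ (k + 1)\<close>.\<close>

lemma down_up:
  "keq (kmul (down (Suc j)) (up (Suc k) (Suc m)))
     (kscale ((1 - fps_X ^ Suc k) ^ (Suc j * Suc m)) (kmul (up (Suc k) (Suc m)) (down (Suc j))))"
proof (induction j)
  case 0
  then show ?case using down_up_right by simp
next
  case (Suc j)
  let ?c = "1 - fps_X ^ Suc k :: complex fps" and ?U = "up (Suc k) (Suc m)"
  have D: "keq (down (Suc (Suc j))) (kmul (down (Suc j)) (down 1))"
    and D': "keq (kmul (down (Suc j)) (down 1)) (down (Suc (Suc j)))"
    by (rule keq_eqI; simp only: down_compose)+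
  have "keq (kmul (down (Suc (Suc j))) ?U) (kmul (kmul (down (Suc j)) (down 1)) ?U)"
    by (rule keq_right[OF D graded_up])
  also have "\<dots> = kmul (down (Suc j)) (kmul (down 1) ?U)" by (rule kmul_assoc)
  also have "keq \<dots> (kmul (down (Suc j)) (kscale (?c ^ Suc m) (kmul ?U (down 1))))"
    by (rule keq_left[OF down_up_right])
  also have "\<dots> = kscale (?c ^ Suc m) (kmul (kmul (down (Suc j)) ?U) (down 1))"
    by (simp only: kmul_scale_right kmul_assoc)
  also have "keq \<dots> (kscale (?c ^ Suc m) (kmul (kscale (?c ^ (Suc j
      * Suc m)) (kmul ?U (down (Suc j)))) (down 1)))"
    by (intro keq_scale keq_right Suc graded_down)
  also have "\<dots> = kscale (?c ^ (Suc (Suc j) * Suc m)) (kmul ?U (kmul (down (Suc j)) (down 1)))"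
    by (simp only: kmul_scale_left kscale_kscale kmul_assoc power_add[symmetric] mult_Suc)
  also have "keq \<dots> (kscale (?c ^ (Suc (Suc j) * Suc m)) (kmul ?U (down (Suc (Suc j)))))"
    by (intro keq_scale keq_left D')
  finally show ?case .
qed

definition vtrace :: "nat \<Rightarrow> nat \<Rightarrow> complex fps" where
  "vtrace k m = (\<Sum>x\<in>shapes. fps_X ^ shape_size x * kmul (up k m) (down m) x x)"

text \<open>Cyclicity of the trace turns \<open>up k\<close> into \<open>up (k + 1)\<close>, since moving it past the grading operator
  multiplies its strips by \<open>x\<close>; commuting the two operators back costs the displayed factor.\<close>

lemma vtrace_step:
  "agree N (vtrace k (Suc m)) ((1 - fps_X ^ Suc k) ^ (Suc m * Suc m) * vtrace (Suc k) (Suc m))"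
proof -
  let ?U = "up (Suc k) (Suc m)" and ?D = "down (Suc m)"
  let ?c = "(1 - fps_X ^ Suc k) ^ (Suc m * Suc m) :: complex fps"
  have "vtrace k (Suc m) = (\<Sum>x\<in>shapes. \<Sum>t\<in>shapes. ?U x t * fps_X ^ shape_size t * ?D t x)"
    unfolding vtrace_def kmul_def sum_distrib_left
    by (intro sum.cong refl) (simp only: up_shift mult.assoc[symmetric])
  also have "\<dots> = (\<Sum>t\<in>shapes. kmul ?D ?U t t * fps_X ^ shape_size t)"
    unfolding kmul_def sum_distrib_right by (subst sum.swap) (simp only: mult_ac)
  finally have 1: "vtrace k (Suc m) = (\<Sum>t\<in>shapes. kmul ?D ?U t t * fps_X ^ shape_size t)" .
  have 2: "c * vtrace (Suc k) (Suc m) = (\<Sum>t\<in>shapes. kscale c (kmul ?U ?D) t t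
      * fps_X ^ shape_size t)" for c
  proof -
    have "c * vtrace (Suc k) (Suc m) = (\<Sum>t\<in>shapes. c * (fps_X ^ shape_size t * kmul ?U ?D t t))"
      unfolding vtrace_def by (rule sum_distrib_left)
    also have "\<dots> = (\<Sum>t\<in>shapes. kscale c (kmul ?U ?D) t t * fps_X ^ shape_size t)"
      by (rule sum.cong[OF refl]) (simp add: kscale_def)
    finally show ?thesis .
  qed
  show ?thesis
    unfolding 1 2
  proof (rule agree_sum)
    fix t assume "t \<in> shapes"
    then show "agree N (kmul ?D ?U t t * fps_X ^ shape_size t) (kscale ?c (kmul ?U ?D) t t
        * fps_X ^ shape_size t)"
      using down_up[of m k m] unfolding keq_def by blast
  qed
qed

lemma vtrace_iterate:
  "agree N (vtrace 0 (Suc m)) ((\<Prod>i<k. 1 - fps_X ^ Suc i) ^ (Suc m * Suc m) * vtrace k (Suc m))"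
proof (induction k)
  case (Suc k)
  note Suc
  also have "agree N ((\<Prod>i<k. 1 - fps_X ^ Suc i) ^ (Suc m * Suc m) * vtrace k (Suc m))
      ((\<Prod>i<k. 1 - fps_X ^ Suc i) ^ (Suc m * Suc m) *
        ((1 - fps_X ^ Suc k) ^ (Suc m * Suc m) * vtrace (Suc k) (Suc m)))"
    by (intro agree_mult agree_refl vtrace_step)
  finally show ?case by (simp only: prod.lessThan_Suc power_mult_distrib mult.assoc)
qed simp

text \<open>An off-diagonal term has a nonempty strip: its boxes give at least \<open>x ^ N\<close>,
  and the nonempty shape \<open>x\<close> gives one more power. The diagonal determinants are
  unitriangular.\<close>

lemma vtrace_end: "agree N (vtrace N m) (\<Sum>x\<in>shapes. fps_X ^ shape_size x)"
  unfolding vtrace_def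
proof (rule agree_sum)
  fix x assume x: "x \<in> shapes"
  have xs: "x \<in> sdec rows UNIV" using x by (simp add: shapes_def)
  have off: "agree N (fps_X ^ shape_size x * (up N m x t * down m t x)) 0"
    if t: "t \<in> shapes - {x}" for t
  proof (cases "fdet rows (\<lambda>i j. hh (of_nat m) (x i) (t j)) = 0")
    case False
    have ts: "t \<in> sdec rows UNIV" using t by (simp add: shapes_def)
    have le: "t i \<le> x i" if "i < rows" for i using fdet_hh_nonzero[OF xs ts False that] .
    have "\<exists>i<rows. t i \<noteq> x i" using t sdec_ext[OF ts xs] by auto
    then obtain i where "i < rows" "t i < x i" using le by (metis le_neq_implies_less)
    then have "0 < skew_size rows x t"
      unfolding skew_size_def by (intro sum_pos2[of _ i]) auto
    moreover have "shape_size x = shape_size t + skew_size rows x t"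
      using le by (intro shape_size_skew[OF xs ts])
    moreover have "N \<le> N * skew_size rows x t" using calculation(1) by simp
    ultimately have "N < shape_size x + N * skew_size rows x t" by linarith
    then have "agree N (fps_const (fdet rows (\<lambda>i j. hh (of_nat m) (x i) (t j))) * down m t x *
        fps_X ^ (shape_size x + N * skew_size rows x t)) 0"
      by (rule agree_X_power)
    then show ?thesis by (simp only: up_def power_add mult_ac)
  qed (simp add: up_def)
  have tri: "fdet rows (\<lambda>i j. f (x i) (x j)) = 1"
    if "\<And>a. f a a = 1" "\<And>a b. a < b \<Longrightarrow> f a b = (0::complex)" for f
    using that sdec_less[OF xs] by (subst fdet_upper_triangular) (auto simp del: prod.lessThan_Suc)
  have "fdet rows (\<lambda>i j. hh (of_nat m) (x i) (x j))
      = 1" "fdet rows (\<lambda>i j. ee (of_nat m) (x i) (x j)) = 1"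
    by (rule tri; simp add: hh_def ee_def)+
  then have diag: "up N m x x * down m x x = 1"
    by (simp add: up_def down_def skew_size_def)
  have "fps_X ^ shape_size x * kmul (up N m) (down m) x x
      = fps_X ^ shape_size x * (up N m x x * down m x x) + (\<Sum>t\<in>shapes - {x}. fps_X ^ shape_size x * (up N m x t * down m t x))"
    unfolding kmul_def using x by (simp add: sum.remove distrib_left sum_distrib_left)
  moreover have "agree N (\<Sum>t\<in>shapes - {x}. fps_X ^ shape_size x * (up N m x t
      * down m t x)) (\<Sum>t\<in>shapes - {x}. 0)"
    by (rule agree_sum) (rule off)
  ultimately show "agree N (fps_X ^ shape_size x * kmul (up N m) (down m) x x) (fps_X ^ shape_size x)"
    using agree_add[OF agree_refl[of N "fps_X ^ shape_size x"]] diag by fastforce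
qed

section \<open>From encoded shapes back to partitions\<close>

lemma length_le_sum_list: "l \<in> partitions \<Longrightarrow> length l \<le> sum_list l"
proof (induction l)
  case (Cons a l)
  then have "l \<in> partitions" "a > 0" by (auto simp: partitions_def)
  then show ?case using Cons.IH by simp
qed simp

lemma shape_size_beta:
  assumes "l \<in> partitions" "length l \<le> rows"
  shows "shape_size (beta_seq rows l) = sum_list l"
  unfolding shape_size_def sum_beta[OF assms(2)] base_size_def by simp

lemma bij_betw_shapes: "bij_betw (beta_seq rows) {l \<in> partitions. sum_list l \<le> N} shapes"
proof -
  have "{l \<in> partitions. sum_list l \<le> N} = {l \<in> {l \<in> partitions. length l \<le> rows}. beta_seq rows l \<in> shapes}"
    using length_le_sum_list shape_size_beta beta_seq_sdec by (fastforce simp: shapes_iff)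
  moreover have "bij_betw (beta_seq rows) {l \<in> {l \<in> partitions. length l \<le> rows}. beta_seq rows l \<in> shapes} {L \<in> sdec rows UNIV. L \<in> shapes}"
    using bij_betw_beta[of rows] by (auto simp: bij_betw_def inj_on_def)
  moreover have "{L \<in> sdec rows UNIV. L \<in> shapes} = shapes" by (auto simp: shapes_def)
  ultimately show ?thesis by simp
qed

text \<open>At \<open>k = 0\<close> strips carry no power of \<open>x\<close>, so the diagonal
  entries are the sums evaluated by \<open>diagonal_hook_sum\<close>.\<close>

lemma vtrace_hooks:
  "vtrace 0 m = (\<Sum>l | l \<in> partitions \<and> sum_list l \<le> N. fps_X ^ sum_list l *
     fps_const (\<Prod>v\<in>boxes l. 1 - (of_nat m)\<^sup>2 / (of_nat (hook_length l v))\<^sup>2))"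
proof -
  have "vtrace 0 m = (\<Sum>l | l \<in> partitions \<and> sum_list l \<le> N. fps_X ^ shape_size (beta_seq rows l) *
      kmul (up 0 m) (down m) (beta_seq rows l) (beta_seq rows l))"
    unfolding vtrace_def by (rule sum.reindex_bij_betw[OF bij_betw_shapes, symmetric])
  also have "\<dots> = (\<Sum>l | l \<in> partitions \<and> sum_list l \<le> N. fps_X ^ sum_list l *
     fps_const (\<Prod>v\<in>boxes l. 1 - (of_nat m)\<^sup>2 / (of_nat (hook_length l v))\<^sup>2))"
  proof (rule sum.cong[OF refl])
    fix l assume "l \<in> {l. l \<in> partitions \<and> sum_list l \<le> N}"
    then have l: "l \<in> partitions" "length l \<le> rows" "sum_list l \<le> N"
      using length_le_sum_list[of l] by auto
    define x where "x = beta_seq rows l"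
    have x: "x \<in> shapes" using bij_betw_shapes l by (auto simp: bij_betw_def x_def)
    have xs: "x \<in> sdec rows UNIV" using x by (simp add: shapes_def)
    let ?f = "\<lambda>t. fdet rows (\<lambda>i j. hh (of_nat m) (x i) (t j))
        * fdet rows (\<lambda>i j. ee (of_nat m) (x i) (t j))"
    have "kmul (up 0 m) (down m) x x = fps_const (\<Sum>t\<in>shapes. ?f t)"
      by (simp add: kmul_def up_def down_def fps_const_sum)
    also have "(\<Sum>t\<in>shapes. ?f t) = (\<Sum>t\<in>sdec rows {..N + base_size}. ?f t)"
    proof (rule sum_shapes_extend)
      fix t assume t: "t \<in> sdec rows {..N + base_size}" and "?f t \<noteq> 0"
      then have "fdet rows (\<lambda>i j. hh (of_nat m) (x i) (t j)) \<noteq> 0" by auto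
      then show "t \<in> shapes" using fdet_hh_nonzero[OF xs t] by (intro shapes_lower[OF x t]) auto
    qed
    also have "\<dots> = (\<Prod>v\<in>boxes l. 1 - (of_nat m)\<^sup>2 / (of_nat (hook_length l v))\<^sup>2)"
      unfolding x_def
        using shapes_sdec[OF x] by (intro diagonal_hook_sum[OF l(1,2)]) (simp add: x_def)
    finally show "fps_X ^ shape_size (beta_seq rows l)
        * kmul (up 0 m) (down m) (beta_seq rows l) (beta_seq rows l) =
        fps_X ^ sum_list l *
        fps_const (\<Prod>v\<in>boxes l. 1 - (of_nat m)\<^sup>2 / (of_nat (hook_length l v))\<^sup>2)"
      by (simp only: x_def shape_size_beta[OF l(1,2)])
  qed
  finally show ?thesis .
qed

lemma size_sum: "(\<Sum>x\<in>shapes. fps_X ^ shape_size x) = (\<Sum>l | l \<in> partitions \<and> sum_list l \<le> N. fps_X ^ sum_list l :: complex fps)"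
proof -
  have "(\<Sum>x\<in>shapes. fps_X ^ shape_size x) = (\<Sum>l | l \<in> partitions \<and> sum_list l \<le> N. fps_X ^ shape_size (beta_seq rows l) :: complex fps)"
    by (rule sum.reindex_bij_betw[OF bij_betw_shapes, symmetric])
  also have "\<dots> = (\<Sum>l | l \<in> partitions \<and> sum_list l \<le> N. fps_X ^ sum_list l)"
    using length_le_sum_list by (intro sum.cong refl) (force simp: shape_size_beta)
  finally show ?thesis .
qed

end

text \<open>A finite stand-in for the infinite product: up to \<open>x ^ N\<close> it does not
  change beyond \<open>n = N\<close>, see \<open>agree_qpoch\<close>.\<close>

definition qpoch :: "nat \<Rightarrow> complex fps" where
  "qpoch n = (\<Prod>i<n. 1 - fps_X ^ Suc i)"

lemma finite_partitions: "finite {l \<in> partitions. sum_list l \<le> N}"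
  using strips.bij_betw_shapes[of N] strips.finite_shapes[of N] bij_betw_finite by blast

lemma finite_boxes: "finite (boxes l)"
  by (simp add: boxes_def)

lemma hook_one:
  assumes "l \<in> partitions" "l \<noteq> []"
  shows "\<exists>v\<in>boxes l. hook_length l v = 1"
proof
  let ?i = "length l" and ?j = "part l (length l)"
  have j: "?j > 0" using assms by (auto simp: part_def partitions_def)
  have "conj_part l ?j \<le> ?i" by (rule conj_part_le_length)
  then show "hook_length l (?i, ?j) = 1" by (simp add: hook_length_def)
  show "(?i, ?j) \<in> boxes l" using j assms(2) by (auto simp: boxes_def Suc_le_eq)
qed

text \<open>At \<open>m = 0\<close>, that is \<open>\<beta> = 1\<close>, only the empty partition survives; this evaluates the unknown
  \<open>\<Sum>l. x ^ |l|\<close> in the trace formula.\<close>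

lemma nekrasov_okounkov_square:
  "agree N (\<Sum>l | l \<in> partitions \<and> sum_list l \<le> N. fps_X ^ sum_list l *
      fps_const (\<Prod>v\<in>boxes l. 1 - (of_nat (Suc m))\<^sup>2 / (of_nat (hook_length l v))\<^sup>2))
    (qpoch N ^ (Suc m * Suc m - 1))"
proof -
  let ?H = "\<lambda>m. \<Sum>l | l \<in> partitions \<and> sum_list l \<le> N. fps_X ^ sum_list l *
      fps_const (\<Prod>v\<in>boxes l. 1 - (of_nat (Suc m))\<^sup>2 / (of_nat (hook_length l v))\<^sup>2) :: complex fps"
  let ?S = "\<Sum>l | l \<in> partitions \<and> sum_list l \<le> N. fps_X ^ sum_list l :: complex fps"
  have H: "agree N (?H m) (qpoch N ^ (Suc m * Suc m) * ?S)" for m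
  proof -
    have "agree N (?H m) (qpoch N ^ (Suc m * Suc m) * strips.vtrace N N (Suc m))"
      unfolding strips.vtrace_hooks[symmetric] qpoch_def by (rule strips.vtrace_iterate)
    moreover have "agree N (qpoch N ^ (Suc m * Suc m)
        * strips.vtrace N N (Suc m)) (qpoch N ^ (Suc m * Suc m) * ?S)"
      unfolding strips.size_sum[symmetric] by (intro agree_mult agree_refl strips.vtrace_end)
    ultimately show ?thesis by (rule agree_trans)
  qed
  have "?H 0 = 1"
  proof -
    have "?H 0 = (\<Sum>l\<in>{[]}. fps_X ^ sum_list l *
      fps_const (\<Prod>v\<in>boxes l. 1 - (of_nat (Suc 0))\<^sup>2 / (of_nat (hook_length l v))\<^sup>2))"
    proof (rule sum.mono_neutral_right)
      show "\<forall>l\<in>{l \<in> partitions. sum_list l \<le> N} - {[]}. fps_X ^ sum_list l *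
          fps_const (\<Prod>v\<in>boxes l. 1 - (of_nat (Suc 0))\<^sup>2 / (of_nat (hook_length l v))\<^sup>2) = (0 :: complex fps)"
      proof
        fix l assume "l \<in> {l \<in> partitions. sum_list l \<le> N} - {[]}"
        then obtain v where "v \<in> boxes l" "hook_length l v = 1" using hook_one by blast
        then have "(\<Prod>v\<in>boxes l. 1 - (of_nat (Suc 0))\<^sup>2 / (of_nat (hook_length l v))\<^sup>2 :: complex)
            = 0"
          by (intro prod_zero bexI[of _ v]) (simp_all add: finite_boxes)
        then show "fps_X ^ sum_list l *
          fps_const (\<Prod>v\<in>boxes l. 1 - (of_nat (Suc 0))\<^sup>2 / (of_nat (hook_length l v))\<^sup>2) = (0 :: complex fps)"
          by simp
      qed
    qed (use finite_partitions in \<open>auto simp: partitions_def\<close>)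
    then show ?thesis by (simp add: boxes_def)
  qed
  then have S: "agree N (qpoch N * ?S) 1" using H[of 0] by (simp add: agree_sym)
  have eq: "qpoch N ^ (Suc m * Suc m) * ?S = qpoch N ^ (Suc m * Suc m - 1) * (qpoch N * ?S)"
    by (simp add: mult_ac)
  have "agree N (qpoch N ^ (Suc m * Suc m - 1) * (qpoch N * ?S)) (qpoch N ^ (Suc m * Suc m - 1)
      * 1)"
    by (intro agree_mult agree_refl S)
  from agree_trans[OF H[of m, unfolded eq] this] show ?thesis by (simp only: mult_1_right)
qed

section \<open>Cauchy's identity with finitely many rows\<close>

lemma qpoch_nth_0: "fps_nth (qpoch n) 0 = 1"
  by (induction n) (simp_all add: qpoch_def)

lemma qpoch_inverse: "qpoch n * inverse (qpoch n) = 1"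
  using qpoch_nth_0[of n] by (metis inverse_mult_eq_1' one_neq_zero)

lemma qpoch_Suc: "qpoch (Suc n) = qpoch n * (1 - fps_X ^ Suc n)"
  by (simp add: qpoch_def)

lemma inverse_qpoch_Suc: "(1 - fps_X ^ Suc n) * inverse (qpoch (Suc n)) = inverse (qpoch n)"
proof -
  have "inverse (qpoch n) * (qpoch (Suc n) * inverse (qpoch (Suc n)))
      = (qpoch n * inverse (qpoch n)) * ((1 - fps_X ^ Suc n) * inverse (qpoch (Suc n)))"
    unfolding qpoch_Suc by (simp only: mult_ac)
  then show ?thesis by (simp only: qpoch_inverse mult_1_right mult_1_left)
qed

text \<open>Telescoping: the term of index \<open>K + 1\<close> is
  \<open>inverse (qpoch (K + 1)) - inverse (qpoch K)\<close>.\<close>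

lemma euler_partial_sum: "(\<Sum>L\<le>K. fps_X ^ L * inverse (qpoch L)) = inverse (qpoch K)"
proof (induction K)
  case (Suc K)
  then show ?case using inverse_qpoch_Suc[of K] by (simp add: algebra_simps)
qed (simp add: qpoch_def)

lemma agree_qpoch: "N \<le> K \<Longrightarrow> agree N (qpoch K) (qpoch N)"
proof (induction K rule: dec_induct)
  case (step K)
  have "agree N (qpoch K * (1 - 1 * fps_X ^ Suc K)) (qpoch N * (1 - 0))"
    using step by (intro agree_mult agree_diff agree_refl agree_X_power) auto
  then show ?case by (simp add: qpoch_Suc)
qed simp

lemma agree_inverse:
  fixes f g :: "'a::field fps"
  assumes "agree N f g" "fps_nth f 0 \<noteq> 0" "fps_nth g 0 \<noteq> 0"
  shows "agree N (inverse f) (inverse g)"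
proof -
  have "agree N (inverse f * inverse g * g) (inverse f * inverse g * f)"
    by (intro agree_mult agree_refl agree_sym[OF assms(1)])
  then show ?thesis
    using inverse_mult_eq_1[OF assms(2)] inverse_mult_eq_1[OF assms(3)]
    by (simp add: mult.assoc mult.left_commute[of "inverse f" "inverse g" f])
qed

lemma agree_dt:
  fixes f g :: "nat \<Rightarrow> nat \<Rightarrow> 'a::comm_ring_1 fps"
  assumes "\<And>i j. i < n \<Longrightarrow> j < n \<Longrightarrow> agree N (f i j) (g i j)"
  shows "agree N (fdet n f) (fdet n g)"
  unfolding fdet_perm
proof (intro agree_sum agree_mult agree_refl agree_prod)
  fix p i assume "p \<in> {p. p permutes {..<n}}" "i \<in> {..<n}"
  then show "agree N (f i (p i)) (g i (p i))"
    using permutes_in_image[of p "{..<n}" i] by (intro assms) auto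
qed

text \<open>Up to truncation at \<open>K\<close>, the coefficient of \<open>t^k\<close> in the sum
  over \<open>L\<close> of \<open>((1 + t) x^(l + 1))^L / qpoch L\<close>, which by Euler is the
  product over \<open>r > l\<close> of \<open>1 / (1 - (1 + t) x^r)\<close>.\<close>

definition cauchy_entry :: "nat \<Rightarrow> nat \<Rightarrow> nat \<Rightarrow> complex fps" where
  "cauchy_entry K k l = (\<Sum>L\<le>K. of_nat (L choose k) * (fps_X ^ (l * L) * (fps_X ^ L
      * inverse (qpoch L))))"

text \<open>Raising \<open>l\<close> multiplies the generating function in \<open>t\<close> by
  \<open>1 - (1 + t) x^(l + 1)\<close>. Truncation leaves one boundary term, a multiple of
  \<open>x^(K + 1)\<close>.\<close>

lemma cauchy_entry_rec:
  "agree K (cauchy_entry K k (Suc l))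
    ((1 - fps_X ^ Suc l) * cauchy_entry K k l
      - fps_X ^ Suc l * (if k = 0 then 0 else cauchy_entry K (k - 1) l))"
proof -
  define w where "w L = fps_X ^ L * inverse (qpoch L)" for L
  define c where "c L = (of_nat (L choose k) + (if k
      = 0 then 0 else of_nat (L choose (k - 1))) :: complex fps)" for L
  have w: "(1 - fps_X ^ Suc L) * w (Suc L) = fps_X * w L" for L
    unfolding w_def using inverse_qpoch_Suc[of L] by (simp only: power_Suc mult_ac)
  have entry: "cauchy_entry K k l = (\<Sum>L\<le>K. of_nat (L choose k) * (fps_X ^ (l * L) * w L))" for k l
    by (simp add: cauchy_entry_def w_def)
  have c: "of_nat (Suc L choose k) = c L" for L
    unfolding c_def by (cases k) (simp_all add: add.commute)
  have "cauchy_entry K k l - cauchy_entry K k (Suc l)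
      = (\<Sum>L\<le>K. of_nat (L choose k) * (fps_X ^ (l * L) * ((1 - fps_X ^ L) * w L)))"
    unfolding entry sum_subtractf[symmetric]
    by (intro sum.cong refl) (simp add: algebra_simps power_add)
  also have "\<dots> = (\<Sum>L<K. of_nat (Suc L choose k) * (fps_X ^ (l * Suc L) * ((1 - fps_X ^ Suc L)
      * w (Suc L))))"
    unfolding lessThan_Suc_atMost[symmetric] sum.lessThan_Suc_shift by simp
  also have "\<dots> = fps_X ^ Suc l * (\<Sum>L<K. c L * (fps_X ^ (l * L) * w L))"
    unfolding sum_distrib_left w c
    by (intro sum.cong refl) (simp add: power_add mult_ac)
  finally have 1: "cauchy_entry K k l - cauchy_entry K k (Suc l)
      = fps_X ^ Suc l * (\<Sum>L<K. c L * (fps_X ^ (l * L) * w L))" .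
  have 2: "(\<Sum>L\<le>K. c L * (fps_X ^ (l * L) * w L))
      = cauchy_entry K k l + (if k = 0 then 0 else cauchy_entry K (k - 1) l)"
    by (simp add: c_def entry algebra_simps sum.distrib)
  have 3: "(\<Sum>L\<le>K. c L * (fps_X ^ (l * L) * w L))
      = (\<Sum>L<K. c L * (fps_X ^ (l * L) * w L)) + c K * (fps_X ^ (l * K) * w K)"
    unfolding lessThan_Suc_atMost[symmetric] by simp
  have "cauchy_entry K k (Suc l) = (1 - fps_X ^ Suc l) * cauchy_entry K k l
      - fps_X ^ Suc l * (if k = 0 then 0 else cauchy_entry K (k - 1) l)
      + (c K * (fps_X ^ l * (fps_X ^ (l * K) * inverse (qpoch K)))) * fps_X ^ Suc K"
  proof -
    let ?E = "fps_X ^ Suc l :: complex fps"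
    have "cauchy_entry K k (Suc l) = cauchy_entry K k l - ?E * (\<Sum>L<K. c L * (fps_X ^ (l * L)
        * w L))"
      using 1 by (simp add: algebra_simps)
    also have "(\<Sum>L<K. c L * (fps_X ^ (l * L) * w L)) = cauchy_entry K k l
        + (if k = 0 then 0 else cauchy_entry K (k - 1) l) - c K * (fps_X ^ (l * K) * w K)"
      using 2 3 by (simp add: algebra_simps)
    also have "cauchy_entry K k l - ?E * \<dots> = (1 - ?E) * cauchy_entry K k l
        - ?E * (if k = 0 then 0 else cauchy_entry K (k - 1) l) + ?E * (c K * (fps_X ^ (l * K) * w K))"
      by (simp only: algebra_simps mult_1_left)
    also have "?E * (c K * (fps_X ^ (l * K) * w K))
        = (c K * (fps_X ^ l * (fps_X ^ (l * K) * inverse (qpoch K)))) * fps_X ^ Suc K"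
      unfolding w_def power_Suc by (simp only: mult_ac)
    finally show ?thesis .
  qed
  moreover have "agree K ((c K * (fps_X ^ l * (fps_X ^ (l * K) * inverse (qpoch K))))
      * fps_X ^ Suc K) 0"
    by (rule agree_X_power) simp
  ultimately show ?thesis by (metis (no_types, lifting) add.right_neutral agree_add agree_refl)
qed

text \<open>The coefficient of \<open>t^i\<close> in the product of \<open>1 - (1 + t) x^r\<close>
  over \<open>1 \<le> r \<le> l\<close>.\<close>

fun cauchy_coeff :: "nat \<Rightarrow> nat \<Rightarrow> complex fps" where
  "cauchy_coeff i 0 = (if i = 0 then 1 else 0)"
| "cauchy_coeff i (Suc l) = (1 - fps_X ^ Suc l) * cauchy_coeff i l
     - fps_X ^ Suc l * (if i = 0 then 0 else cauchy_coeff (i - 1) l)"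

lemma cauchy_coeff_zero: "l < i \<Longrightarrow> cauchy_coeff i l = 0"
  by (induction l arbitrary: i) auto

lemma cauchy_coeff_diag: "cauchy_coeff l l = (\<Prod>r<l. - (fps_X ^ Suc r))"
  by (induction l) (simp_all add: cauchy_coeff_zero)

lemma cauchy_entry_expand:
  "agree K (cauchy_entry K k l) (\<Sum>i\<le>k. cauchy_entry K (k - i) 0 * cauchy_coeff i l)"
proof (induction l arbitrary: k)
  case 0
  have "(\<Sum>i\<le>k. cauchy_entry K (k - i) 0 * cauchy_coeff i 0)
      = (\<Sum>i\<in>{0}. cauchy_entry K (k - i) 0 * cauchy_coeff i 0)"
    by (rule sum.mono_neutral_right) auto
  then show ?case by simp
next
  case (Suc l)
  let ?M = "\<lambda>k. cauchy_entry K k 0" and ?E = "fps_X ^ Suc l :: complex fps"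
  let ?S = "\<lambda>k. \<Sum>i\<le>k. ?M (k - i) * cauchy_coeff i l"
  have "agree K (cauchy_entry K k (Suc l))
      ((1 - ?E) * ?S k - ?E * (if k = 0 then 0 else ?S (k - 1)))"
  proof (rule agree_trans[OF cauchy_entry_rec])
    have "agree K (if k = 0 then 0 else cauchy_entry K (k - 1) l) (if k = 0 then 0 else ?S (k - 1))"
      using Suc[of "k - 1"] by simp
    then show "agree K ((1 - ?E) * cauchy_entry K k l - ?E * (if k
        = 0 then 0 else cauchy_entry K (k - 1) l))
      ((1 - ?E) * ?S k - ?E * (if k = 0 then 0 else ?S (k - 1)))"
      by (intro agree_diff agree_mult agree_refl Suc)
  qed
  also have "(1 - ?E) * ?S k - ?E * (if k = 0 then 0 else ?S (k - 1))
      = (\<Sum>i\<le>k. ?M (k - i) * cauchy_coeff i (Suc l))"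
  proof (cases k)
    case (Suc k')
    have "(\<Sum>i\<le>k. ?M (k - i) * (if i = 0 then 0 else cauchy_coeff (i - 1) l)) = ?S k'"
      unfolding Suc sum.atMost_Suc_shift by simp
    moreover have "(\<Sum>i\<le>k. ?M (k - i) * cauchy_coeff i (Suc l))
        = (\<Sum>i\<le>k. (1 - ?E) * (?M (k - i) * cauchy_coeff i l)
            - ?E * (?M (k - i) * (if i = 0 then 0 else cauchy_coeff (i - 1) l)))"
      by (intro sum.cong refl) (simp only: cauchy_coeff.simps algebra_simps)
    ultimately show ?thesis
      using Suc by (simp only: sum_subtractf sum_distrib_left[symmetric]) simp
  qed simp
  finally show ?case .
qed

text \<open>The generating function of a column is that of the preceding one times a linear polynomial, so the
  matrix factors as a triangular Toeplitz matrix times a triangular matrix.\<close>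

lemma cauchy_det:
  "agree K (fdet n (cauchy_entry K)) (inverse (qpoch K) ^ n * (\<Prod>l<n. \<Prod>r<l. - (fps_X ^ Suc r)))"
proof -
  let ?F = "\<lambda>k i. if i \<le> k then cauchy_entry K (k - i) 0 else 0"
  have "agree K (fdet n (cauchy_entry K)) (fdet n (\<lambda>k l. \<Sum>i<n. ?F k i * cauchy_coeff i l))"
  proof (rule agree_dt)
    fix k l assume "k < n" "l < n"
    have "(\<Sum>i<n. ?F k i * cauchy_coeff i l) = (\<Sum>i\<le>k. cauchy_entry K (k - i) 0 * cauchy_coeff i l)"
      using \<open>k < n\<close> by (intro sum.mono_neutral_cong_right) auto
    then show "agree K (cauchy_entry K k l) (\<Sum>i<n. ?F k i * cauchy_coeff i l)"
      using cauchy_entry_expand[of K k l] by simp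
  qed
  also have "fdet n (\<lambda>k l. \<Sum>i<n. ?F k i * cauchy_coeff i l) = fdet n ?F * fdet n cauchy_coeff"
    by (rule fdet_mult[symmetric])
  also have "fdet n ?F = inverse (qpoch K) ^ n"
    by (subst fdet_lower_triangular) (auto simp: cauchy_entry_def euler_partial_sum)
  also have "fdet n cauchy_coeff = (\<Prod>l<n. \<Prod>r<l. - (fps_X ^ Suc r))"
    by (subst fdet_upper_triangular) (auto simp: cauchy_coeff_zero cauchy_coeff_diag)
  finally show ?thesis .
qed

text \<open>Falling factorials are monic polynomials and replace the powers in the Vandermonde
  determinant.\<close>

lemma fdet_binomial:
  "(\<Prod>k<n. fact k) * fdet n (\<lambda>j k. of_nat (t j choose k))
      = (\<Prod>j<n. \<Prod>i<j. of_nat (t j) - of_nat (t i) :: 'a::field_char_0)"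
proof -
  let ?p = "\<lambda>k. \<Prod>r<k. [:- of_nat r, 1::'a:]"
  have p: "poly (?p k) (of_nat x) = of_nat (x choose k) * fact k" for k x
    by (simp add: poly_prod binomial_gbinomial gbinomial_prod_rev lessThan_atLeast0)
  have "fdet n (\<lambda>j k. poly (?p k) (of_nat (t j))) = fdet n (\<lambda>j k. of_nat (t j) ^ k)"
    using degree_prod_linear[of "{..<_}" "\<lambda>r. - of_nat r :: 'a"]
      coeff_prod_linear[of "{..<_}" "\<lambda>r. - of_nat r :: 'a"]
    by (subst fdet_poly_triangular) auto
  moreover have "fdet n (\<lambda>j k. poly (?p k) (of_nat (t j)))
      = (\<Prod>k<n. fact k) * fdet n (\<lambda>j k. of_nat (t j choose k))"
    unfolding p using fdet_scale[of n "\<lambda>_. 1" "\<lambda>j k. of_nat (t j choose k)" fact] by simp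
  ultimately show ?thesis by (simp add: vandermonde)
qed

definition left_weight :: "nat \<Rightarrow> nat list \<Rightarrow> complex fps" where
  "left_weight n l = (\<Prod>v\<in>boxes l. fps_const ((of_int (box_content v)
      + of_nat n) / of_nat (hook_length l v)) *
     inverse (1 - fps_X ^ hook_length l v))"

lemma hook_pos: "v \<in> boxes l \<Longrightarrow> 0 < hook_length l v"
  by (cases v) (simp add: hook_length_def)

text \<open>The factorials of \<open>L i\<close> from the contents cancel those from the hook
  lengths; the factors \<open>1 - x^h\<close> come from a second use of
  \<open>hook_product\<close>.\<close>

lemma left_weight_beta:
  assumes l: "l \<in> partitions" "length l \<le> n"
  defines "L \<equiv> beta_seq n l"
  shows "left_weight n l = fps_const ((\<Prod>j<n. \<Prod>i<j. of_nat (L i - L j)) / (\<Prod>k<n. fact k)) *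
    ((\<Prod>j<n. \<Prod>i<j. 1 - fps_X ^ (L i - L j)) * (\<Prod>i<n. inverse (qpoch (L i))))"
proof -
  have dec: "0 < L i - L j" if "i < j" "j < n" for i j
    using sdec_less[OF beta_seq_sdec[OF l(1), of n] that] by (simp add: L_def del: beta_seq_nth)
  let ?c = "(\<Prod>v\<in>boxes l. of_int (box_content v) + of_nat n) :: complex"
  let ?h = "(\<Prod>v\<in>boxes l. of_nat (hook_length l v)) :: complex"
  let ?d = "(\<Prod>j<n. \<Prod>i<j. of_nat (L i - L j)) :: complex"
  let ?q = "(\<Prod>v\<in>boxes l. 1 - fps_X ^ hook_length l v) :: complex fps"
  let ?e = "(\<Prod>j<n. \<Prod>i<j. 1 - fps_X ^ (L i - L j)) :: complex fps"
  have "?h * ?d = (\<Prod>i<n. fact (L i))"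
    using hook_product[OF l, of "of_nat :: nat \<Rightarrow> complex"]
    by (simp add: L_def fact_prod del: beta_seq_nth)
  moreover have "?c * (\<Prod>k<n. fact k) = (\<Prod>i<n. fact (L i))"
    unfolding L_def by (rule content_product[OF l])
  moreover have h0: "?h \<noteq> 0" using hook_pos[of _ l] by (auto simp: prod_zero_iff finite_boxes)
  moreover have "(\<Prod>k<n. fact k :: complex) \<noteq> 0" by (simp add: prod_zero_iff)
  ultimately have ch: "?c / ?h = ?d / (\<Prod>k<n. fact k)" by (simp add: field_simps)
  have "(\<Prod>k = 1..m. 1 - fps_X ^ k) = qpoch m" for m
    unfolding qpoch_def by (rule prod.reindex_bij_witness[of _ Suc "\<lambda>k. k - 1"]) auto
  then have qe: "?q * ?e = (\<Prod>i<n. qpoch (L i))"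
    using hook_product[OF l, of "\<lambda>k. 1 - fps_X ^ k :: complex fps"]
      by (simp add: L_def del: beta_seq_nth)
  have q: "?q * (\<Prod>v\<in>boxes l. inverse (1 - fps_X ^ hook_length l v)) = 1"
    unfolding prod.distrib[symmetric]
    by (intro prod.neutral ballI inverse_mult_eq_1') (simp add: hook_pos)
  have "(\<Prod>v\<in>boxes l. inverse (1 - fps_X ^ hook_length l v)) = ?e * (\<Prod>i<n. inverse (qpoch (L i)))"
  proof -
    have "(\<Prod>i<n. qpoch (L i)) * (\<Prod>i<n. inverse (qpoch (L i))) = 1"
      unfolding prod.distrib[symmetric] qpoch_inverse by simp
    then have z: "?q * (?e * (\<Prod>i<n. inverse (qpoch (L i)))) = 1"
      by (simp add: qe mult.assoc[symmetric])
    have unique: "a = b" if "c * a = 1" "c * b = 1" for a b c :: "complex fps"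
    proof -
      have "a * (c * b) = (c * a) * b" by (simp only: mult_ac)
      then show ?thesis by (simp only: that mult_1_left mult_1_right)
    qed
    show ?thesis by (rule unique[OF q z])
  qed
  moreover have "left_weight n l = fps_const (?c / ?h)
      * (\<Prod>v\<in>boxes l. inverse (1 - fps_X ^ hook_length l v))"
    by (simp add: left_weight_def prod.distrib fps_const_prod[symmetric] prod_dividef)
  ultimately show ?thesis by (simp add: ch)
qed

text \<open>The exponent from the leading coefficients in \<open>cauchy_det\<close> equals the share
  of the staircase in the weighted sum of \<open>L\<close>, so one power of \<open>x\<close> is
  common to all terms.\<close>

lemma cauchy_exponent: "(\<Sum>l<n. \<Sum>r<l. Suc r) = (\<Sum>j<n. (j + 1) * (n - 1 - j))"
proof (induction n)
  case (Suc n)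
  have "(\<Sum>j<Suc n. (j + 1) * (Suc n - 1 - j)) = (\<Sum>j<n. (j + 1) * (n - j))" by simp
  also have "\<dots> = (\<Sum>j<n. (j + 1) * (n - 1 - j) + Suc j)"
  proof (rule sum.cong[OF refl])
    fix j assume "j \<in> {..<n}"
    then obtain d where "n = Suc (j + d)" using less_imp_Suc_add by auto
    then show "(j + 1) * (n - j) = (j + 1) * (n - 1 - j) + Suc j" by simp
  qed
  also have "\<dots> = (\<Sum>j<n. (j + 1) * (n - 1 - j)) + (\<Sum>j<n. Suc j)" by (rule sum.distrib)
  finally show ?case using Suc by simp
qed simp

lemma cauchy_det_expand:
  "fdet n (cauchy_entry K) = (\<Sum>L\<in>sdec n {..K}. fdet n (\<lambda>k j. of_nat (L j choose k)) *
     fdet n (\<lambda>j l. (fps_X ^ L j) ^ l * (fps_X ^ L j * inverse (qpoch (L j)))))"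
  by (subst cauchy_binet) (auto intro!: fdet_cong simp: cauchy_entry_def power_mult[symmetric] mult.commute)

text \<open>The sign stems from the first determinant alone: \<open>L\<close> decreases, so its
  differences are negative, whereas those of the powers of \<open>x\<close> have positive lowest
  term.\<close>

lemma cauchy_term:
  assumes l: "l \<in> partitions" "length l \<le> n"
  defines "L \<equiv> beta_seq n l"
  shows "fdet n (\<lambda>k j. of_nat (L j choose k)) *
     fdet n (\<lambda>j l. (fps_X ^ L j) ^ l * (fps_X ^ L j * inverse (qpoch (L j))))
   = (\<Prod>j<n. \<Prod>i<j. - 1) * fps_X ^ (\<Sum>l<n. \<Sum>r<l. Suc r) * (fps_X ^ (sum_list l + b_stat l) * left_weight n l)"
proof -
  have dec: "L j < L i" if "i < j" "j < n" for i j
    using sdec_less[OF beta_seq_sdec[OF l(1), of n] that] by (simp add: L_def del: beta_seq_nth)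
  define d :: complex where "d = (\<Prod>j<n. \<Prod>i<j. of_nat (L i - L j))"
  define e :: "complex fps" where "e = (\<Prod>j<n. \<Prod>i<j. 1 - fps_X ^ (L i - L j))"
  let ?s = "(\<Prod>j<n. \<Prod>i<j. - 1)"
  have "fdet n (\<lambda>k j. of_nat (L j choose k) :: complex) = ?s * d / (\<Prod>k<n. fact k)"
  proof -
    have "(\<Prod>j<n. \<Prod>i<j. of_nat (L j) - of_nat (L i))
        = (\<Prod>j<n. \<Prod>i<j. - 1 * of_nat (L i - L j) :: complex)"
      using dec by (intro prod.cong refl) (simp add: of_nat_diff less_imp_le)
    then have "(\<Prod>k<n. fact k) * fdet n (\<lambda>j k. of_nat (L j choose k)) = ?s * d"
      unfolding fdet_binomial by (simp only: prod.distrib d_def)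
    moreover have "(\<Prod>k<n. fact k :: complex) \<noteq> 0" by (simp add: prod_zero_iff)
    ultimately show ?thesis
      by (simp add: fdet_transpose[of n "\<lambda>j k. of_nat (L j choose k)", symmetric] field_simps)
  qed
  then have 1: "fdet n (\<lambda>k j. of_nat (L j choose k) :: complex fps)
      = ?s * fps_const (d / (\<Prod>k<n. fact k))"
  proof -
    have "fps_const (fdet n (\<lambda>k j. of_nat (L j choose k)))
        = (fdet n (\<lambda>k j. of_nat (L j choose k)) :: complex fps)"
      unfolding fdet_perm fps_const_sum
      by (intro sum.cong refl) (simp add: fps_const_prod fps_of_nat fps_of_int flip: fps_const_mult)
    moreover have "fps_const ?s = (?s :: complex fps)"
      by (simp add: fps_const_prod flip: fps_const_neg fps_const_power)
    ultimately show ?thesis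
      using \<open>fdet n (\<lambda>k j. of_nat (L j choose k)) = ?s * d / _\<close>
      by (metis fps_const_mult times_divide_eq_right)
  qed
  have "fdet n (\<lambda>j l. (fps_X ^ L j) ^ l * (fps_X ^ L j * inverse (qpoch (L j))))
      = (\<Prod>j<n. fps_X ^ L j * inverse (qpoch (L j))) * (\<Prod>j<n. \<Prod>i<j. fps_X ^ L j - fps_X ^ L i :: complex fps)"
    using fdet_scale[of n "\<lambda>j. fps_X ^ L j * inverse (qpoch (L j))" "\<lambda>j l. (fps_X ^ L j) ^ l" "\<lambda>_. 1"]
    by (simp add: vandermonde mult.commute)
  also have "(\<Prod>j<n. \<Prod>i<j. fps_X ^ L j - fps_X ^ L i :: complex fps)
      = (\<Prod>j<n. \<Prod>i<j. fps_X ^ L j * (1 - fps_X ^ (L i - L j)))"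
  proof (intro prod.cong refl)
    fix i j assume "j \<in> {..<n}" "i \<in> {..<j}"
    then have "fps_X ^ L i = fps_X ^ L j * (fps_X ^ (L i - L j) :: complex fps)"
      using dec[of i j] by (simp add: power_add[symmetric])
    then show "fps_X ^ L j - fps_X ^ L i = fps_X ^ L j * (1 - fps_X ^ (L i - L j) :: complex fps)"
      by (simp add: algebra_simps)
  qed
  also have "(\<Prod>j<n. fps_X ^ L j * inverse (qpoch (L j))) * \<dots>
      = (\<Prod>j<n. fps_X ^ L j * (\<Prod>i<j. fps_X ^ L j)) * (e * (\<Prod>j<n. inverse (qpoch (L j))))"
    by (simp add: prod.distrib e_def mult_ac)
  also have "(\<Prod>j<n. fps_X ^ L j * (\<Prod>i<j. fps_X ^ L j))
      = (fps_X ^ (\<Sum>j<n. (j + 1) * L j) :: complex fps)"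
    by (simp add: power_sum power_mult[symmetric] power_add mult.commute)
  also have "(\<Sum>j<n. (j + 1) * L j) = (\<Sum>l<n. \<Sum>r<l. Suc r) + (sum_list l + b_stat l)"
  proof -
    have "(\<Sum>j<n. (j + 1) * L j) = (\<Sum>j<n. (j + 1) * pad l j + (j + 1) * (n - 1 - j))"
      by (intro sum.cong refl) (simp only: L_def lessThan_iff beta_seq_nth distrib_left)
    also have "\<dots> = (\<Sum>j<n. (j + 1) * pad l j) + (\<Sum>j<n. (j + 1) * (n - 1 - j))"
      by (rule sum.distrib)
    finally show ?thesis unfolding b_stat_pad[OF l(2)] cauchy_exponent by (simp only: add.commute)
  qed
  finally have 2: "fdet n (\<lambda>j l. (fps_X ^ L j) ^ l * (fps_X ^ L j * inverse (qpoch (L j))))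
      = fps_X ^ ((\<Sum>l<n. \<Sum>r<l. Suc r) + (sum_list l + b_stat l)) * (e * (\<Prod>j<n. inverse (qpoch (L j))))" .
  have "left_weight n l = fps_const (d / (\<Prod>k<n. fact k)) * (e * (\<Prod>j<n. inverse (qpoch (L j))))"
    unfolding d_def e_def L_def by (rule left_weight_beta[OF l])
  then show ?thesis unfolding 1 2 power_add by (simp only: mult_ac)
qed

lemma left_weight_zero:
  assumes "l \<in> partitions" "n < length l"
  shows "left_weight n l = 0"
proof -
  have "(\<Prod>v\<in>boxes l. of_int (box_content v) + of_nat n :: complex) = 0"
    by (rule content_product_zero[OF assms])
  then obtain v where "v \<in> boxes l" "of_int (box_content v) + of_nat n = (0::complex)"
    by (auto simp: prod_zero_iff finite_boxes)
  then show ?thesis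
    unfolding left_weight_def by (intro prod_zero finite_boxes bexI[of _ v]) simp_all
qed

lemma agree_cancel_X_power:
  fixes f g :: "'a::comm_ring_1 fps"
  assumes "agree (N + q) (fps_X ^ q * f) (fps_X ^ q * g)"
  shows "agree N f g"
  unfolding agree_def
proof (intro allI impI)
  fix i assume "i \<le> N"
  then have "fps_nth (fps_X ^ q * f) (i + q) = fps_nth (fps_X ^ q * g) (i + q)"
    using assms by (simp add: agree_def)
  then show "fps_nth f i = fps_nth g i" by (simp add: fps_X_power_mult_nth)
qed

lemma agree_mono: "agree K f g \<Longrightarrow> N \<le> K \<Longrightarrow> agree N f g"
  by (simp add: agree_def)

theorem cauchy_identity_rows:
  "agree N (\<Sum>l | l \<in> partitions \<and> sum_list l \<le> N. fps_X ^ (sum_list l + b_stat l) * left_weight n l)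
     (inverse (qpoch N) ^ n)"
proof -
  define q where "q = (\<Sum>l<n. \<Sum>r<l. Suc r)"
  \<comment> \<open>The summand \<open>q\<close> pays for cancelling \<open>x ^ q\<close>; the
    summand \<open>n\<close> makes room for the staircase in the encoded rows.\<close>
  define K where "K = N + q + n"
  let ?s = "(\<Prod>j<n. \<Prod>i<j. - 1) :: complex fps"
  let ?t = "\<lambda>l. fps_X ^ (sum_list l + b_stat l) * left_weight n l"
  define A where "A = {l \<in> {l \<in> partitions. length l \<le> n}. beta_seq n l \<in> sdec n {..K}}"
  have bij: "bij_betw (beta_seq n) A (sdec n {..K})"
  proof -
    have "bij_betw (beta_seq n) A {L \<in> sdec n UNIV. L \<in> sdec n {..K}}"
      unfolding A_def using bij_betw_beta[of n] by (auto simp: bij_betw_def inj_on_def)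
    moreover have "{L \<in> sdec n UNIV. L \<in> sdec n {..K}} = sdec n {..K}"
      using sdec_mono[of "{..K}" UNIV n] by auto
    ultimately show ?thesis by simp
  qed
  have ss: "?s * ?s = 1" by (simp add: prod.distrib[symmetric])
  have "(\<Prod>l<n. \<Prod>r<l. - (fps_X ^ Suc r)) = (\<Prod>l<n. \<Prod>r<l. - 1 * fps_X ^ Suc r :: complex fps)" by simp
  also have "\<dots> = ?s * fps_X ^ q" by (simp only: prod.distrib q_def power_sum)
  finally have sign: "(\<Prod>l<n. \<Prod>r<l. - (fps_X ^ Suc r)) = ?s * fps_X ^ q" .
  have "fdet n (cauchy_entry K) = (\<Sum>l\<in>A. ?s * fps_X ^ q * ?t l)"
    unfolding cauchy_det_expand sum.reindex_bij_betw[OF bij, symmetric] q_def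
    by (intro sum.cong refl cauchy_term) (auto simp: A_def)
  then have "agree K (\<Sum>l\<in>A. ?s * fps_X ^ q * ?t l) (inverse (qpoch K) ^ n * (?s * fps_X ^ q))"
    using cauchy_det[of K n] by (simp only: sign)
  then have "agree K (?s * (\<Sum>l\<in>A. ?s * fps_X ^ q * ?t l)) (?s * (inverse (qpoch K) ^ n * (?s
      * fps_X ^ q)))"
    by (intro agree_mult agree_refl)
  moreover have "?s * (\<Sum>l\<in>A. ?s * fps_X ^ q * ?t l) = (?s * ?s) * (fps_X ^ q * (\<Sum>l\<in>A. ?t l))"
    by (simp only: sum_distrib_left mult_ac)
  moreover have "?s * (inverse (qpoch K) ^ n * (?s * fps_X ^ q))
      = (?s * ?s) * (fps_X ^ q * inverse (qpoch K) ^ n)"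
    by (simp only: mult_ac)
  ultimately have "agree K (fps_X ^ q * (\<Sum>l\<in>A. ?t l)) (fps_X ^ q * inverse (qpoch K) ^ n)"
    by (simp only: ss mult_1_left)
  then have "agree (N + q) (fps_X ^ q * (\<Sum>l\<in>A. ?t l)) (fps_X ^ q * inverse (qpoch K) ^ n)"
    by (rule agree_mono) (simp add: K_def)
  then have main: "agree N (\<Sum>l\<in>A. ?t l) (inverse (qpoch K) ^ n)" by (rule agree_cancel_X_power)
  let ?B = "{l \<in> partitions. sum_list l \<le> N}"
  have finA: "finite A" using bij_betw_finite[OF bij] by simp
  \<comment> \<open>A partition of size at most \<open>N\<close> is missing from \<open>A\<close>
    only if it has more than \<open>n\<close> rows, and then its weight is zero.\<close>
  have 1: "(\<Sum>l\<in>?B. ?t l) = (\<Sum>l\<in>?B \<inter> A. ?t l)"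
  proof (rule sum.mono_neutral_right)
    show "\<forall>l\<in>?B - ?B \<inter> A. ?t l = 0"
    proof
      fix l assume l: "l \<in> ?B - ?B \<inter> A"
      have "n < length l"
      proof (rule ccontr)
        assume "\<not> n < length l"
        then have len: "length l \<le> n" by simp
        have "beta_seq n l i \<le> K" if "i < n" for i
        proof -
          have "pad l i \<le> sum_list l" by (auto simp: pad_def member_le_sum_list)
          moreover have "sum_list l \<le> N" using l by simp
          ultimately have "pad l i + (n - 1 - i) \<le> N + q + n" by linarith
          then show ?thesis by (simp only: K_def beta_seq_nth[OF that])
        qed
        then have "beta_seq n l \<in> sdec n {..K}"
          using beta_seq_sdec[of l n] l by (auto simp: sdec_def)
        then show False using l len by (auto simp: A_def)
      qed
      then show "?t l = 0" using left_weight_zero l by simp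
    qed
  qed (use finite_partitions in auto)
  have 2: "agree N (\<Sum>l\<in>A. ?t l) (\<Sum>l\<in>?B \<inter> A. ?t l)"
  proof -
    have "agree N (\<Sum>l\<in>A. ?t l) (\<Sum>l\<in>A. if l \<in> ?B then ?t l else 0)"
    proof (rule agree_sum)
      fix l assume "l \<in> A"
      show "agree N (?t l) (if l \<in> ?B then ?t l else 0)"
      proof (cases "l \<in> ?B")
        case False
        then have "N < sum_list l + b_stat l" using \<open>l \<in> A\<close> by (auto simp: A_def)
        then have "agree N (left_weight n l * fps_X ^ (sum_list l + b_stat l)) 0"
          by (rule agree_X_power)
        then show ?thesis using False by (simp only: mult.commute[of "left_weight n l"] if_False)
      qed simp
    qed
    also have "(\<Sum>l\<in>A. if l \<in> ?B then ?t l else 0) = (\<Sum>l\<in>?B \<inter> A. ?t l)"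
      unfolding Int_commute[of ?B] by (rule sum.inter_restrict[OF finA, symmetric])
    finally show ?thesis .
  qed
  have 3: "agree N (inverse (qpoch K) ^ n) (inverse (qpoch N) ^ n)"
  proof -
    have "agree N (inverse (qpoch K)) (inverse (qpoch N))"
      using agree_qpoch[of N K] by (intro agree_inverse) (simp_all add: qpoch_nth_0 K_def)
    then have "agree N (\<Prod>i<n. inverse (qpoch K)) (\<Prod>i<n. inverse (qpoch N))" by (rule agree_prod)
    then show ?thesis by simp
  qed
  show ?thesis unfolding 1 by (rule agree_trans[OF agree_sym[OF 2] agree_trans[OF main 3]])
qed

section \<open>Polynomial dependence on the parameter\<close>

definition polyfun :: "(complex \<Rightarrow> complex) \<Rightarrow> bool" where
  "polyfun f \<longleftrightarrow> (\<exists>p. \<forall>z. f z = poly p z)"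

lemma polyfun_const [simp]: "polyfun (\<lambda>_. c)"
  unfolding polyfun_def by (rule exI[of _ "[:c:]"]) simp

lemma polyfun_id [simp]: "polyfun (\<lambda>z. z)"
  unfolding polyfun_def by (rule exI[of _ "[:0, 1:]"]) simp

lemma polyfun_add: "polyfun f \<Longrightarrow> polyfun g \<Longrightarrow> polyfun (\<lambda>z. f z + g z)"
  unfolding polyfun_def by (metis poly_add)

lemma polyfun_mult: "polyfun f \<Longrightarrow> polyfun g \<Longrightarrow> polyfun (\<lambda>z. f z * g z)"
  unfolding polyfun_def by (metis poly_mult)

lemma polyfun_diff: "polyfun f \<Longrightarrow> polyfun g \<Longrightarrow> polyfun (\<lambda>z. f z - g z)"
  unfolding polyfun_def by (metis poly_diff)

lemma polyfun_sum: "(\<And>x. x \<in> A \<Longrightarrow> polyfun (f x)) \<Longrightarrow> polyfun (\<lambda>z. \<Sum>x\<in>A. f x z)"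
  by (induction A rule: infinite_finite_induct) (auto intro: polyfun_add)

lemma polyfun_prod: "(\<And>x. x \<in> A \<Longrightarrow> polyfun (f x)) \<Longrightarrow> polyfun (\<lambda>z. \<Prod>x\<in>A. f x z)"
  by (induction A rule: infinite_finite_induct) (auto intro: polyfun_mult)

lemmas polyfun_intros = polyfun_const polyfun_id polyfun_add polyfun_mult polyfun_diff
  polyfun_sum polyfun_prod

lemma polyfun_eqI:
  assumes "polyfun f" "polyfun g" and inf: "infinite S" and eq: "\<And>z. z \<in> S \<Longrightarrow> f z = g z"
  shows "f = g"
proof -
  obtain p q where p: "\<And>z. f z = poly p z" and q: "\<And>z. g z = poly q z"
    using assms(1,2) unfolding polyfun_def by blast
  have "S \<subseteq> {z. poly (p - q) z = 0}" using eq p q by auto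
  then have "infinite {z. poly (p - q) z = 0}" using inf finite_subset by blast
  then have "p - q = 0" using poly_roots_finite by blast
  then show ?thesis using p q by (simp add: fun_eq_iff)
qed

text \<open>The power \<open>f ^ c\<close> through the binomial series, meant for constant term 1.
  Its coefficients are polynomials in \<open>c\<close>.\<close>

definition fps_pow :: "complex fps \<Rightarrow> complex \<Rightarrow> complex fps" where
  "fps_pow f c = fps_binomial c oo (f - 1)"

lemma fps_pow_of_nat:
  assumes "fps_nth f 0 = 1"
  shows "fps_pow f (of_nat n) = f ^ n"
proof -
  have "(1 + fps_X) ^ n oo (f - 1) = ((1 + fps_X) oo (f - 1)) ^ n"
    using assms by (intro fps_compose_power[symmetric]) simp
  then show ?thesis
    using assms by (simp add: fps_pow_def fps_binomial_of_nat fps_compose_add_distrib)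
qed

lemma fps_pow_minus_of_nat:
  assumes "fps_nth f 0 = 1"
  shows "fps_pow f (- of_nat n) = inverse f ^ n"
proof -
  have 0: "fps_nth (f - 1) 0 = 0" using assms by simp
  have "fps_binomial (- of_nat n) = (inverse (1 + fps_X) ^ n :: complex fps)"
    by (simp add: fps_binomial_minus_of_nat fps_inverse_power)
  then have "fps_pow f (- of_nat n) = (inverse (1 + fps_X) oo (f - 1)) ^ n"
    unfolding fps_pow_def using fps_compose_power[OF 0] by simp
  also have "inverse (1 + fps_X) oo (f - 1) = inverse ((1 + fps_X) oo (f - 1))"
    using 0 by (intro fps_inverse_compose) simp_all
  also have "(1 + fps_X) oo (f - 1) = f"
    using assms by (simp add: fps_compose_add_distrib)
  finally show ?thesis .
qed

lemma polyfun_fps_pow: "polyfun (\<lambda>z. fps_nth (fps_pow f (z - 1)) N)"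
  by (simp add: fps_pow_def fps_compose_nth gbinomial_prod_rev divide_inverse polyfun_intros)

definition left_term :: "complex \<Rightarrow> nat list \<Rightarrow> complex fps" where
  "left_term \<beta> l = fps_X ^ (sum_list l + b_stat l) *
      (\<Prod>v \<in> boxes l. fps_const (of_int (box_content v) + 1 - \<beta>) /
        (fps_const (of_nat (hook_length l v)) * (1 - fps_X ^ hook_length l v)))"

definition right_term :: "complex \<Rightarrow> nat list \<Rightarrow> complex fps" where
  "right_term \<beta> l = fps_X ^ sum_list l *
      (\<Prod>v \<in> boxes l. fps_const ((of_nat (hook_length l v) ^ 2 - \<beta>) / of_nat (hook_length l v) ^ 2))"

text \<open>With \<open>\<beta>\<close> confined to a constant factor, the polynomial dependence of
  each coefficient is visible.\<close>

lemma left_term_alt: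
  "left_term \<beta> l = fps_const (\<Prod>v\<in>boxes l. (of_int (box_content v)
      + 1 - \<beta>) / of_nat (hook_length l v)) *
     (fps_X ^ (sum_list l + b_stat l) * (\<Prod>v\<in>boxes l. inverse (1 - fps_X ^ hook_length l v)))"
proof -
  have "fps_const c / (fps_const (of_nat h) * (1 - fps_X ^ h))
      = fps_const (c / of_nat h) * inverse (1 - fps_X ^ h)"
    if "0 < h" for c :: complex and h
    using that by (subst fps_divide_unit)
      (simp_all add: fps_inverse_mult fps_const_inverse[symmetric] divide_inverse mult.assoc flip: fps_const_mult)
  then have "left_term \<beta> l = fps_X ^ (sum_list l + b_stat l) *
      (\<Prod>v\<in>boxes l. fps_const ((of_int (box_content v) + 1 - \<beta>) / of_nat (hook_length l v)) *
        inverse (1 - fps_X ^ hook_length l v))"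
    unfolding left_term_def
      using hook_pos by (intro arg_cong2[of _ _ _ _ "(*)"] prod.cong refl) blast
  then show ?thesis by (simp only: prod.distrib fps_const_prod mult_ac)
qed

lemma right_term_alt:
  "right_term \<beta> l = fps_X ^ sum_list l * fps_const (\<Prod>v\<in>boxes l. 1
      - \<beta> / (of_nat (hook_length l v))\<^sup>2)"
proof -
  have "(of_nat (hook_length l v) ^ 2 - \<beta>) / of_nat (hook_length l v) ^ 2
      = 1 - \<beta> / (of_nat (hook_length l v))\<^sup>2"
    if "v \<in> boxes l" for v
    using hook_pos[OF that] by (simp add: field_simps)
  then show ?thesis
    unfolding right_term_def fps_const_prod
      by (intro arg_cong2[of _ _ _ _ "(*)"] prod.cong refl) simp
qed

lemma left_term_nth_0: "N < sum_list l \<Longrightarrow> fps_nth (left_term \<beta> l) N = 0"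
  by (simp add: left_term_def fps_X_power_mult_nth)

lemma right_term_nth_0: "N < sum_list l \<Longrightarrow> fps_nth (right_term \<beta> l) N = 0"
  by (simp add: right_term_def fps_X_power_mult_nth)

lemma infinite_squares: "infinite ((\<lambda>m. (of_nat (Suc m))\<^sup>2 :: complex) ` UNIV)"
proof -
  have "inj (\<lambda>m. (of_nat (Suc m))\<^sup>2 :: complex)"
  proof (rule injI)
    fix i j assume "(of_nat (Suc i))\<^sup>2 = ((of_nat (Suc j))\<^sup>2 :: complex)"
    then have "(Suc i)\<^sup>2 = (Suc j)\<^sup>2" by (metis of_nat_eq_iff of_nat_power)
    then show "i = j" by simp
  qed
  then show ?thesis by (simp add: finite_image_iff)
qed

lemma right_sum:
  "(\<Sum>l | l \<in> partitions \<and> sum_list l \<le> N. fps_nth (right_term \<beta> l) N)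
      = fps_nth (fps_pow (qpoch N) (\<beta> - 1)) N"
proof -
  let ?f = "\<lambda>\<beta>. \<Sum>l | l \<in> partitions \<and> sum_list l \<le> N. fps_nth (right_term \<beta> l) N"
  have "?f = (\<lambda>\<beta>. fps_nth (fps_pow (qpoch N) (\<beta> - 1)) N)"
  proof (rule polyfun_eqI[OF _ polyfun_fps_pow infinite_squares])
    show "polyfun ?f"
      unfolding right_term_alt divide_inverse
      by (auto intro!: polyfun_intros)
    fix z assume "z \<in> range (\<lambda>m. (of_nat (Suc m))\<^sup>2 :: complex)"
    then obtain m where z: "z = (of_nat (Suc m))\<^sup>2" by blast
    have "?f z = fps_nth (qpoch N ^ (Suc m * Suc m - 1)) N"
      unfolding fps_sum_nth[symmetric] right_term_alt z
      using nekrasov_okounkov_square[of N m] by (simp add: agree_def)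
    also have "qpoch N ^ (Suc m * Suc m - 1) = fps_pow (qpoch N) (of_nat (Suc m * Suc m - 1))"
      by (simp only: fps_pow_of_nat[OF qpoch_nth_0])
    also have "of_nat (Suc m * Suc m - 1) = z - 1"
      by (simp add: z power2_eq_square algebra_simps)
    finally show "?f z = fps_nth (fps_pow (qpoch N) (z - 1)) N" .
  qed
  then show ?thesis by (rule fun_cong)
qed

lemma left_sum:
  "(\<Sum>l | l \<in> partitions \<and> sum_list l \<le> N. fps_nth (left_term \<beta> l) N)
      = fps_nth (fps_pow (qpoch N) (\<beta> - 1)) N"
proof -
  let ?f = "\<lambda>\<beta>. \<Sum>l | l \<in> partitions \<and> sum_list l \<le> N. fps_nth (left_term \<beta> l) N"
  have inf: "infinite (range (\<lambda>n. 1 - of_nat n :: complex))"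
    by (subst finite_image_iff) (auto simp: inj_def)
  have "?f = (\<lambda>\<beta>. fps_nth (fps_pow (qpoch N) (\<beta> - 1)) N)"
  proof (rule polyfun_eqI[OF _ polyfun_fps_pow inf])
    show "polyfun ?f"
      unfolding left_term_alt divide_inverse
      by (auto intro!: polyfun_intros)
    fix z assume "z \<in> range (\<lambda>n. 1 - of_nat n :: complex)"
    then obtain n where z: "z = 1 - of_nat n" by blast
    have "left_term z l = fps_X ^ (sum_list l + b_stat l) * left_weight n l" for l
      by (simp add: left_term_alt left_weight_def z prod.distrib fps_const_prod mult_ac)
    then have "?f z = fps_nth (inverse (qpoch N) ^ n) N"
      using cauchy_identity_rows[of N n] by (simp add: agree_def fps_sum_nth)
    also have "inverse (qpoch N) ^ n = fps_pow (qpoch N) (- of_nat n)"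
      by (rule fps_pow_minus_of_nat[OF qpoch_nth_0, symmetric])
    also have "- of_nat n = z - 1" by (simp add: z)
    finally show "?f z = fps_nth (fps_pow (qpoch N) (z - 1)) N" .
  qed
  then show ?thesis by (rule fun_cong)
qed

text \<open>Convergence of power series is coefficientwise: the coefficient of \<open>x^N\<close> is
  final once a finite set contains the partitions of size at most \<open>N\<close>.\<close>

lemma has_sum_partitions:
  fixes f :: "nat list \<Rightarrow> complex fps"
  assumes "\<And>l N. N < sum_list l \<Longrightarrow> fps_nth (f l) N = 0"
  shows "(f has_sum Abs_fps (\<lambda>N. \<Sum>l | l \<in> partitions \<and> sum_list l \<le> N. fps_nth (f l) N)) partitions"
  unfolding has_sum_def
proof (rule tendsto_fpsI)
  fix N
  let ?B = "{l \<in> partitions. sum_list l \<le> N}"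
  have "\<forall>\<^sub>F F in finite_subsets_at_top partitions. finite F \<and> ?B \<subseteq> F \<and> F \<subseteq> partitions"
    unfolding eventually_finite_subsets_at_top using finite_partitions by (intro exI[of _ ?B]) auto
  then show "\<forall>\<^sub>F F in finite_subsets_at_top partitions. fps_nth (sum f F) N =
      fps_nth (Abs_fps (\<lambda>N. \<Sum>l | l \<in> partitions \<and> sum_list l \<le> N. fps_nth (f l) N)) N"
  proof eventually_elim
    case (elim F)
    have "fps_nth (f l) N = 0" if "l \<in> F - ?B" for l
      using elim that by (intro assms) auto
    then have "(\<Sum>l\<in>F. fps_nth (f l) N) = (\<Sum>l\<in>?B. fps_nth (f l) N)"
      using elim by (intro sum.mono_neutral_right) auto
    then show ?case by (simp add: fps_sum_nth)
  qed
qed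

theorem theorem8p5:
  fixes \<beta> :: complex
  defines "L \<equiv> \<lambda>l. fps_X ^ (sum_list l + b_stat l) *
      (\<Prod>v \<in> boxes l. fps_const (of_int (box_content v) + 1 - \<beta>) /
        (fps_const (of_nat (hook_length l v)) * (1 - fps_X ^ hook_length l v)))"
    and "R \<equiv> \<lambda>l. fps_X ^ sum_list l *
      (\<Prod>v \<in> boxes l. fps_const ((of_nat (hook_length l v) ^ 2 - \<beta>) / of_nat (hook_length l v) ^ 2))"
  shows "L summable_on partitions \<and> R summable_on partitions \<and>
    (\<Sum>\<^sub>\<infinity>l\<in>partitions. L l) = (\<Sum>\<^sub>\<infinity>l\<in>partitions. R l)"
proof -
  \<comment> \<open>The infinite product raised to \<open>\<beta> - 1\<close>, each coefficient
    being read off from a finite product that is long enough for it.\<close>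
  define S where "S = Abs_fps (\<lambda>N. fps_nth (fps_pow (qpoch N) (\<beta> - 1)) N)"
  have "L = left_term \<beta>" "R = right_term \<beta>"
    by (simp_all add: L_def R_def left_term_def right_term_def fun_eq_iff)
  moreover have "(left_term \<beta> has_sum S) partitions"
    using has_sum_partitions[of "left_term \<beta>"] left_term_nth_0 by (simp add: left_sum S_def)
  moreover have "(right_term \<beta> has_sum S) partitions"
    using has_sum_partitions[of "right_term \<beta>"] right_term_nth_0 by (simp add: right_sum S_def)
  ultimately have "(L has_sum S) partitions" "(R has_sum S) partitions" by simp_all
  then show ?thesis by (auto simp: summable_on_def infsumI)
qed

end
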